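(* There exist an infinite-dimensional separable complex Hilbert space $\mathcal{H}$ and bounded linear operators $T,D,K$ on $\mathcal{H}$ such that $T=D+K$, $D$ is a diagonal operator, $K$ is compact, $T$ is hyponormal, $[T^*,T]$ is trace-class, and yet $T$ is not normal and $[K^*,K]$ is not trace-class.
   Context: For a bounded operator $A$, $[A^*,A]=A^*A-AA^*$. A bounded operator $T$ is hyponormal if $[T^*,T]$ is positive semi-definite. A diagonal operator is a bounded operator $D$ for which there is an orthonormal basis $\{e_n\}_{n\in\mathbb{N}}$ of $\mathcal{H}$ and a bounded complex sequence $\{\lambda_n\}$ with $De_n=\lambda_n e_n$ for all $n$. *)

theory Defs
  imports "HOL-Analysis.Analysis" "HOL-Library.Function_Algebras"
begin

text \<open>
  A Hilbert space is a value, so that one can quantify over it: a carrier inside an ambient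
  abelian group \<open>'a\<close>, a complex scalar multiplication and an inner product (linear in the first
  argument). Only the values of \<open>hinner\<close>, and of operators, on the carrier are meaningful.
\<close>

record 'a hspace =
  hcarrier :: "'a set"
  hscale :: "complex \<Rightarrow> 'a \<Rightarrow> 'a"
  hinner :: "'a \<Rightarrow> 'a \<Rightarrow> complex"

definition hnorm :: "('a::ab_group_add) hspace \<Rightarrow> 'a \<Rightarrow> real" where
  "hnorm H x = sqrt (Re (hinner H x x))"

text \<open>
  The value 0 outside the carrier is a dummy: the library's \<open>Metric_space\<close> demands
  nonnegativity and symmetry of the distance on the whole type.
\<close>

definition hdist :: "('a::ab_group_add) hspace \<Rightarrow> 'a \<Rightarrow> 'a \<Rightarrow> real" where
  "hdist H x y = (if x \<in> hcarrier H \<and> y \<in> hcarrier H then hnorm H (x - y) else 0)"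

definition htopology :: "('a::ab_group_add) hspace \<Rightarrow> 'a topology" where
  "htopology H = Metric_space.mtopology (hcarrier H) (hdist H)"

locale complex_inner_product_space = vector_space "hscale H"
  for H :: "('a::ab_group_add) hspace" +
  assumes carrier_subspace: "subspace (hcarrier H)"
    and inner_add_left: "\<lbrakk>x \<in> hcarrier H; y \<in> hcarrier H; z \<in> hcarrier H\<rbrakk>
          \<Longrightarrow> hinner H (x + y) z = hinner H x z + hinner H y z"
    and inner_scale_left: "\<lbrakk>x \<in> hcarrier H; y \<in> hcarrier H\<rbrakk>
          \<Longrightarrow> hinner H (hscale H c x) y = c * hinner H x y"
    and inner_commute: "\<lbrakk>x \<in> hcarrier H; y \<in> hcarrier H\<rbrakk>
          \<Longrightarrow> hinner H x y = cnj (hinner H y x)"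
    and inner_ge_zero: "x \<in> hcarrier H \<Longrightarrow> 0 \<le> Re (hinner H x x)"
    and inner_eq_zeroD: "\<lbrakk>x \<in> hcarrier H; hinner H x x = 0\<rbrakk> \<Longrightarrow> x = 0"
begin

lemma carrier_closed [simp, intro]:
  "0 \<in> hcarrier H"
  "\<lbrakk>x \<in> hcarrier H; y \<in> hcarrier H\<rbrakk> \<Longrightarrow> x + y \<in> hcarrier H"
  "\<lbrakk>x \<in> hcarrier H; y \<in> hcarrier H\<rbrakk> \<Longrightarrow> x - y \<in> hcarrier H"
  "x \<in> hcarrier H \<Longrightarrow> hscale H c x \<in> hcarrier H"
  using carrier_subspace by (auto intro: subspace_0 subspace_add subspace_diff subspace_scale)

lemma inner_add_right:
  assumes "x \<in> hcarrier H" "y \<in> hcarrier H" "z \<in> hcarrier H"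
  shows "hinner H z (x + y) = hinner H z x + hinner H z y"
  using assms by (metis carrier_closed(2) complex_cnj_add inner_add_left inner_commute)

lemma inner_scale_right:
  assumes "x \<in> hcarrier H" "y \<in> hcarrier H"
  shows "hinner H x (hscale H c y) = cnj c * hinner H x y"
  using assms by (metis carrier_closed(4) complex_cnj_mult inner_scale_left inner_commute)

lemma inner_self_eq:
  assumes "x \<in> hcarrier H"
  shows "hinner H x x = complex_of_real (Re (hinner H x x))"
  using inner_commute[OF assms assms] by (simp add: complex_eq_iff)

lemma hnorm_sq: "x \<in> hcarrier H \<Longrightarrow> (hnorm H x)\<^sup>2 = Re (hinner H x x)"
  by (simp add: hnorm_def inner_ge_zero)

lemma hnorm_ge_zero: "x \<in> hcarrier H \<Longrightarrow> 0 \<le> hnorm H x"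
  by (simp add: hnorm_def inner_ge_zero)

lemma hnorm_eq_zero_iff:
  assumes "x \<in> hcarrier H"
  shows "hnorm H x = 0 \<longleftrightarrow> x = 0"
proof
  assume "hnorm H x = 0"
  then have "Re (hinner H x x) = 0" by (simp add: hnorm_def)
  then have "hinner H x x = 0" using inner_self_eq[OF assms] by simp
  then show "x = 0" using assms inner_eq_zeroD by blast
next
  assume "x = 0"
  moreover have "hinner H 0 0 = 0"
    using inner_scale_left[of 0 0 0] by simp
  ultimately show "hnorm H x = 0" by (simp add: hnorm_def)
qed

lemma hnorm_scale:
  assumes "x \<in> hcarrier H"
  shows "hnorm H (hscale H c x) = cmod c * hnorm H x"
proof -
  have "hinner H (hscale H c x) (hscale H c x) = complex_of_real ((cmod c)\<^sup>2) * hinner H x x"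
    unfolding complex_norm_square using assms
    by (simp add: inner_scale_left inner_scale_right ac_simps)
  then have "Re (hinner H (hscale H c x) (hscale H c x)) = (cmod c)\<^sup>2 * Re (hinner H x x)"
    by simp
  then show ?thesis by (simp add: hnorm_def real_sqrt_mult)
qed

lemma hnorm_sq_add_scale:
  assumes "x \<in> hcarrier H" "y \<in> hcarrier H"
  shows "(hnorm H (x + hscale H c y))\<^sup>2
    = (hnorm H x)\<^sup>2 + 2 * Re (cnj c * hinner H x y) + (cmod c)\<^sup>2 * (hnorm H y)\<^sup>2"
proof -
  have c: "c * hinner H y x = cnj (cnj c * hinner H x y)"
    using inner_commute[OF assms] by simp
  have r: "Re (c * hinner H y x) = Re (cnj c * hinner H x y)"
    unfolding c by simp
  have "(hnorm H (x + hscale H c y))\<^sup>2 = Re (hinner H (x + hscale H c y) (x + hscale H c y))"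
    using assms by (simp add: hnorm_sq)
  also have "\<dots> = Re (hinner H x x) + Re (cnj c * hinner H x y) + Re (c * hinner H y x)
      + (hnorm H (hscale H c y))\<^sup>2"
    using assms by (simp add: hnorm_sq inner_add_left inner_add_right inner_scale_left
        inner_scale_right distrib_left del: times_complex.sel)
  also have "\<dots> = (hnorm H x)\<^sup>2 + 2 * Re (cnj c * hinner H x y) + (cmod c)\<^sup>2 * (hnorm H y)\<^sup>2"
    using assms by (simp add: hnorm_sq r hnorm_scale power_mult_distrib del: times_complex.sel)
  finally show ?thesis .
qed

lemma cauchy_schwarz:
  assumes "x \<in> hcarrier H" "y \<in> hcarrier H"
  shows "cmod (hinner H x y) \<le> hnorm H x * hnorm H y"
proof (cases "y = 0")
  case True
  have "hinner H x 0 = 0" using inner_scale_right[of x 0 0] assms by simp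
  then show ?thesis using True hnorm_eq_zero_iff[of 0] by simp
next
  case False
  define n where "n = (hnorm H y)\<^sup>2"
  have n: "n > 0" using False assms hnorm_eq_zero_iff n_def by simp
  define a where "a = hinner H x y"
  define c where "c = - a / complex_of_real n"
  have "cnj c * a = - complex_of_real ((cmod a)\<^sup>2 / n)"
    by (simp add: c_def complex_norm_square mult.commute del: of_real_power)
  then have 1: "Re (cnj c * a) = - ((cmod a)\<^sup>2 / n)"
    by (metis Re_complex_of_real uminus_complex.sel(1))
  have "(cmod c)\<^sup>2 * n = (cmod a)\<^sup>2 / n"
    using n by (simp add: c_def norm_divide power_divide power2_eq_square)
  then have "0 \<le> (hnorm H x)\<^sup>2 - (cmod a)\<^sup>2 / n"
    using hnorm_sq_add_scale[OF assms, of c] 1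
      zero_le_power2[of "hnorm H (x + hscale H c y)"] unfolding n_def a_def by linarith
  then have "(cmod a)\<^sup>2 \<le> (hnorm H x * hnorm H y)\<^sup>2"
    using n by (simp add: field_simps n_def power_mult_distrib)
  then show ?thesis
    unfolding a_def using assms hnorm_ge_zero power2_le_imp_le mult_nonneg_nonneg by metis
qed

lemma hnorm_triangle:
  assumes "x \<in> hcarrier H" "y \<in> hcarrier H"
  shows "hnorm H (x + y) \<le> hnorm H x + hnorm H y"
proof -
  have "(hnorm H (x + y))\<^sup>2 = (hnorm H x)\<^sup>2 + 2 * Re (hinner H x y) + (hnorm H y)\<^sup>2"
    using hnorm_sq_add_scale[OF assms, of 1] by simp
  also have "\<dots> \<le> (hnorm H x + hnorm H y)\<^sup>2"
    using cauchy_schwarz[OF assms] complex_Re_le_cmod[of "hinner H x y"]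
    by (simp add: power2_sum)
  finally show ?thesis
    using assms hnorm_ge_zero by (meson add_nonneg_nonneg power2_le_imp_le)
qed

sublocale Metric_space "hcarrier H" "hdist H"
proof
  fix x y
  show "0 \<le> hdist H x y" by (simp add: hdist_def hnorm_ge_zero)
  have "hnorm H (y - x) = hnorm H (x - y)" if "x \<in> hcarrier H" "y \<in> hcarrier H"
    using hnorm_scale[of "x - y" "-1"] that by simp
  then show "hdist H x y = hdist H y x" by (simp add: hdist_def)
next
  fix x y assume "x \<in> hcarrier H" "y \<in> hcarrier H"
  then show "hdist H x y = 0 \<longleftrightarrow> x = y"
    using hnorm_eq_zero_iff[of "x - y"] by (simp add: hdist_def)
next
  fix x y z assume "x \<in> hcarrier H" "y \<in> hcarrier H" "z \<in> hcarrier H"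
  then show "hdist H x z \<le> hdist H x y + hdist H y z"
    using hnorm_triangle[of "x - y" "y - z"] by (simp add: hdist_def)
qed

end

locale complex_hilbert_space = complex_inner_product_space +
  assumes complete: "mcomplete"

definition infinite_dimensional :: "('a::ab_group_add) hspace \<Rightarrow> bool" where
  "infinite_dimensional H \<longleftrightarrow>
     \<not> (\<exists>B. finite B \<and> module.span (hscale H) B = hcarrier H)"

definition separable :: "('a::ab_group_add) hspace \<Rightarrow> bool" where
  "separable H \<longleftrightarrow>
     (\<exists>C. countable C \<and> C \<subseteq> hcarrier H \<and> htopology H closure_of C = hcarrier H)"

definition orthonormal_basis :: "('a::ab_group_add) hspace \<Rightarrow> (nat \<Rightarrow> 'a) \<Rightarrow> bool" where
  "orthonormal_basis H e \<longleftrightarrow>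
     range e \<subseteq> hcarrier H \<and>
     (\<forall>m n. hinner H (e m) (e n) = (if m = n then 1 else 0)) \<and>
     htopology H closure_of (module.span (hscale H) (range e)) = hcarrier H"

definition bounded_operator :: "('a::ab_group_add) hspace \<Rightarrow> ('a \<Rightarrow> 'a) \<Rightarrow> bool" where
  "bounded_operator H A \<longleftrightarrow>
     A \<in> hcarrier H \<rightarrow> hcarrier H \<and>
     (\<forall>x\<in>hcarrier H. \<forall>y\<in>hcarrier H. A (x + y) = A x + A y) \<and>
     (\<forall>c. \<forall>x\<in>hcarrier H. A (hscale H c x) = hscale H c (A x)) \<and>
     (\<exists>C. \<forall>x\<in>hcarrier H. hnorm H (A x) \<le> C * hnorm H x)"

text \<open>
  For a bounded operator on a Hilbert space the described vector exists by the Riesz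
  representation theorem.
\<close>

definition adjoint_op :: "('a::ab_group_add) hspace \<Rightarrow> ('a \<Rightarrow> 'a) \<Rightarrow> 'a \<Rightarrow> 'a" where
  "adjoint_op H A y =
     (THE z. z \<in> hcarrier H \<and> (\<forall>x\<in>hcarrier H. hinner H (A x) y = hinner H x z))"

definition self_commutator :: "('a::ab_group_add) hspace \<Rightarrow> ('a \<Rightarrow> 'a) \<Rightarrow> 'a \<Rightarrow> 'a" where
  "self_commutator H A x = adjoint_op H A (A x) - A (adjoint_op H A x)"

definition positive_semidefinite :: "('a::ab_group_add) hspace \<Rightarrow> ('a \<Rightarrow> 'a) \<Rightarrow> bool" where
  "positive_semidefinite H A \<longleftrightarrow>
     bounded_operator H A \<and>
     (\<forall>x\<in>hcarrier H. hinner H (A x) x \<in> \<real> \<and> 0 \<le> Re (hinner H (A x) x))"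

definition normal_operator :: "('a::ab_group_add) hspace \<Rightarrow> ('a \<Rightarrow> 'a) \<Rightarrow> bool" where
  "normal_operator H A \<longleftrightarrow>
     bounded_operator H A \<and>
     (\<forall>x\<in>hcarrier H. adjoint_op H A (A x) = A (adjoint_op H A x))"

definition hyponormal_operator :: "('a::ab_group_add) hspace \<Rightarrow> ('a \<Rightarrow> 'a) \<Rightarrow> bool" where
  "hyponormal_operator H A \<longleftrightarrow>
     bounded_operator H A \<and> positive_semidefinite H (self_commutator H A)"

definition diagonal_operator :: "('a::ab_group_add) hspace \<Rightarrow> ('a \<Rightarrow> 'a) \<Rightarrow> bool" where
  "diagonal_operator H A \<longleftrightarrow>
     bounded_operator H A \<and>
     (\<exists>e lam. orthonormal_basis H e \<and> bounded (range lam) \<and>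
        (\<forall>n. A (e n) = hscale H (lam n) (e n)))"

definition compact_operator :: "('a::ab_group_add) hspace \<Rightarrow> ('a \<Rightarrow> 'a) \<Rightarrow> bool" where
  "compact_operator H A \<longleftrightarrow>
     bounded_operator H A \<and>
     compactin (htopology H)
       (htopology H closure_of (A ` {x \<in> hcarrier H. hnorm H x \<le> 1}))"

text \<open>\<open>P\<close> is the positive square root of \<open>A\<^sup>*A\<close>.\<close>

definition is_modulus :: "('a::ab_group_add) hspace \<Rightarrow> ('a \<Rightarrow> 'a) \<Rightarrow> ('a \<Rightarrow> 'a) \<Rightarrow> bool" where
  "is_modulus H A P \<longleftrightarrow>
     positive_semidefinite H P \<and> (\<forall>x\<in>hcarrier H. P (P x) = adjoint_op H A (A x))"

text \<open>
  The modulus exists and is unique on the carrier, and the trace of a positive operator does not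
  depend on the basis, so the existential quantifiers below could equally be universal. Bases are
  indexed by \<open>nat\<close>: the notion is meant for infinite-dimensional separable spaces only.
\<close>

definition trace_class :: "('a::ab_group_add) hspace \<Rightarrow> ('a \<Rightarrow> 'a) \<Rightarrow> bool" where
  "trace_class H A \<longleftrightarrow>
     bounded_operator H A \<and>
     (\<exists>P e. is_modulus H A P \<and> orthonormal_basis H e \<and>
        summable (\<lambda>n. Re (hinner H (P (e n)) (e n))))"

end

theory Submission
  imports Defs
begin

text \<open>
  Let \<open>S\<close> be the unilateral shift and \<open>N\<^sub>k\<close> a direct sum of weighted cyclic shifts, one of length
  \<open>2j + 1\<close> and constant weight \<open>j / (j + k + 1)\<close> for each \<open>j\<close>; it is normal and diagonalizable. Cutting the
  cycles open and rejoining them slowly (Berg's technique: rotate by \<open>\<pi>/2\<close> within the plane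
  of two parallel strands while moving along them) turns \<open>N\<^sub>k\<close>, up to a compact operator that
  tends to \<open>0\<close> with \<open>k\<close>, into a forward line \<open>W\<^sub>k\<close> plus a backward line \<open>B\<^sub>k\<close>, that is, weighted shifts whose weights
  increase slowly to \<open>1\<close>, and \<open>W\<^sub>k - W\<^sub>k\<^sub>+\<^sub>1\<close> is small. Hence, up to compact operators,
  \<open>S \<oplus> N\<^sub>0 \<oplus> N\<^sub>1 \<oplus> \<dots>\<close> is \<open>W\<^sub>0 \<oplus> (W\<^sub>1 \<oplus> B\<^sub>0) \<oplus> (W\<^sub>2 \<oplus> B\<^sub>1) \<oplus> \<dots>\<close>,
  which regroups as \<open>(W\<^sub>0 \<oplus> B\<^sub>0) \<oplus> (W\<^sub>1 \<oplus> B\<^sub>1) \<oplus> \<dots>\<close>, a compact perturbation of the diagonal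
  operator \<open>N\<^sub>0 \<oplus> N\<^sub>1 \<oplus> \<dots>\<close>. So \<open>T = S \<oplus> N\<^sub>0 \<oplus> \<dots>\<close> is hyponormal with rank-one
  self-commutator, and diagonal plus compact. On the common kernel of both operators one adds the
  self-adjoint \<open>\<Oplus> a\<^sub>n \<sigma>\<^sub>x\<close> to \<open>T\<close> and the diagonal \<open>\<Oplus> \<i> a\<^sub>n \<sigma>\<^sub>z\<close> to \<open>D\<close> with \<open>a\<^sub>n \<rightarrow> 0\<close>: this changes
  neither property of \<open>T\<close>, but \<open>K\<close> acquires a summand with self-commutator \<open>\<Oplus> \<plusminus>4 a\<^sub>n\<^sup>2 \<sigma>\<^sub>y\<close>, which is not
  trace-class when \<open>\<Sum> a\<^sub>n\<^sup>2 = \<infinity>\<close>.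
\<close>

section \<open>Adjoint pairs and the trace\<close>

text \<open>\<open>adjoint_op\<close> is a definite description, meaningful in general only through
  the Riesz theorem. Carrying an explicit adjoint along reduces its evaluation to
  uniqueness.\<close>

definition adjoint_pair :: "('a::ab_group_add) hspace \<Rightarrow> ('a \<Rightarrow> 'a) \<Rightarrow> ('a \<Rightarrow> 'a) \<Rightarrow> bool" where
  "adjoint_pair H A B \<longleftrightarrow> bounded_operator H A \<and> bounded_operator H B \<and>
     (\<forall>x\<in>hcarrier H. \<forall>y\<in>hcarrier H. hinner H (A x) y = hinner H x (B y))"

lemma adjoint_pairD:
  assumes "adjoint_pair H A B"
  shows "bounded_operator H A" "bounded_operator H B"
    "\<lbrakk>x \<in> hcarrier H; y \<in> hcarrier H\<rbrakk> \<Longrightarrow> hinner H (A x) y = hinner H x (B y)"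
  using assms by (auto simp: adjoint_pair_def)

lemma bounded_operatorD:
  assumes "bounded_operator H A"
  shows "x \<in> hcarrier H \<Longrightarrow> A x \<in> hcarrier H"
    "\<lbrakk>x \<in> hcarrier H; y \<in> hcarrier H\<rbrakk> \<Longrightarrow> A (x + y) = A x + A y"
    "x \<in> hcarrier H \<Longrightarrow> A (hscale H c x) = hscale H c (A x)"
  using assms by (auto simp: bounded_operator_def)

context complex_inner_product_space
begin

lemma inner_diff_left:
  assumes "x \<in> hcarrier H" "y \<in> hcarrier H" "z \<in> hcarrier H"
  shows "hinner H (x - y) z = hinner H x z - hinner H y z"
  using inner_add_left[of "x - y" y z] assms by (simp add: algebra_simps)

lemma inner_diff_right:
  assumes "x \<in> hcarrier H" "y \<in> hcarrier H" "z \<in> hcarrier H"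
  shows "hinner H z (x - y) = hinner H z x - hinner H z y"
  using inner_add_right[of "x - y" y z] assms by (simp add: algebra_simps)

lemma inner_zero_left [simp]: "y \<in> hcarrier H \<Longrightarrow> hinner H 0 y = 0"
  using inner_scale_left[of 0 y 0] by simp

lemma inner_zero_right [simp]: "y \<in> hcarrier H \<Longrightarrow> hinner H y 0 = 0"
  using inner_scale_right[of y 0 0] by simp

lemma sum_closed: "(\<And>i. i \<in> I \<Longrightarrow> f i \<in> hcarrier H) \<Longrightarrow> sum f I \<in> hcarrier H"
  using carrier_subspace by (rule subspace_sum)

lemma inner_sum_left:
  assumes "\<And>i. i \<in> I \<Longrightarrow> f i \<in> hcarrier H" "y \<in> hcarrier H"
  shows "hinner H (\<Sum>i\<in>I. f i) y = (\<Sum>i\<in>I. hinner H (f i) y)"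
  using assms
proof (induction I rule: infinite_finite_induct)
  case (insert i I)
  then show ?case by (simp add: inner_add_left sum_closed)
qed auto

lemma inner_sum_right:
  assumes "\<And>i. i \<in> I \<Longrightarrow> f i \<in> hcarrier H" "y \<in> hcarrier H"
  shows "hinner H y (\<Sum>i\<in>I. f i) = (\<Sum>i\<in>I. hinner H y (f i))"
  using assms
proof (induction I rule: infinite_finite_induct)
  case (insert i I)
  then show ?case by (simp add: inner_add_right sum_closed)
qed auto

text \<open>The difference of two candidates is orthogonal to the whole carrier, in particular to
  itself.\<close>

lemma adjoint_op_eq:
  assumes "adjoint_pair H A B" "y \<in> hcarrier H"
  shows "adjoint_op H A y = B y"
  unfolding adjoint_op_def
proof (rule the_equality)
  show "B y \<in> hcarrier H \<and> (\<forall>x\<in>hcarrier H. hinner H (A x) y = hinner H x (B y))"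
    using assms by (auto dest: adjoint_pairD bounded_operatorD)
next
  fix z assume z: "z \<in> hcarrier H \<and> (\<forall>x\<in>hcarrier H. hinner H (A x) y = hinner H x z)"
  have By: "B y \<in> hcarrier H"
    using assms by (auto dest: adjoint_pairD bounded_operatorD)
  have "hinner H (z - B y) z = hinner H (z - B y) (B y)"
    using z adjoint_pairD(3)[OF assms(1) _ assms(2), of "z - B y"] By by auto
  then have "hinner H (z - B y) (z - B y) = 0"
    using z By by (simp add: inner_diff_right)
  then show "z = B y"
    using inner_eq_zeroD[of "z - B y"] z By by auto
qed

lemma adjoint_pair_sym: "adjoint_pair H A B \<Longrightarrow> adjoint_pair H B A"
  unfolding adjoint_pair_def by (metis bounded_operatorD(1) inner_commute)

lemma bounded_operator_bound:
  assumes "bounded_operator H A"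
  obtains C where "C \<ge> 0" "\<And>x. x \<in> hcarrier H \<Longrightarrow> hnorm H (A x) \<le> C * hnorm H x"
proof -
  obtain C where C: "\<And>x. x \<in> hcarrier H \<Longrightarrow> hnorm H (A x) \<le> C * hnorm H x"
    using assms unfolding bounded_operator_def by metis
  \<comment> \<open>Nothing in \<open>bounded_operator\<close> makes \<open>C\<close> nonnegative,
    hence the maximum.\<close>
  have "hnorm H (A x) \<le> max C 0 * hnorm H x" if "x \<in> hcarrier H" for x
    using C[OF that] mult_right_mono[OF max.cobounded1 hnorm_ge_zero[OF that], of C 0] by linarith
  then show ?thesis using that[of "max C 0"] by auto
qed

lemma bounded_operator_compose:
  assumes A: "bounded_operator H A" and B: "bounded_operator H B"
  shows "bounded_operator H (\<lambda>x. A (B x))"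
proof -
  obtain a b where a: "a \<ge> 0" "\<And>x. x \<in> hcarrier H \<Longrightarrow> hnorm H (A x) \<le> a * hnorm H x"
    and b: "\<And>x. x \<in> hcarrier H \<Longrightarrow> hnorm H (B x) \<le> b * hnorm H x"
    using bounded_operator_bound[OF A] bounded_operator_bound[OF B] by metis
  have "hnorm H (A (B x)) \<le> (a * b) * hnorm H x" if "x \<in> hcarrier H" for x
    using a(2)[OF bounded_operatorD(1)[OF B that]] mult_left_mono[OF b[OF that] a(1)]
    by (simp add: mult.assoc)
  then show ?thesis
    using bounded_operatorD[OF A] bounded_operatorD[OF B] unfolding bounded_operator_def by auto
qed

lemma hnorm_diff_le:
  assumes "x \<in> hcarrier H" "y \<in> hcarrier H"
  shows "hnorm H (x - y) \<le> hnorm H x + hnorm H y"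
  using hnorm_triangle[of x "hscale H (-1) y"] assms hnorm_scale[of y "-1"]
    carrier_closed(4)[of y "-1"] by simp

lemma bounded_operator_diff:
  assumes A: "bounded_operator H A" and B: "bounded_operator H B"
  shows "bounded_operator H (\<lambda>x. A x - B x)"
proof -
  obtain a b where a: "\<And>x. x \<in> hcarrier H \<Longrightarrow> hnorm H (A x) \<le> a * hnorm H x"
    and b: "\<And>x. x \<in> hcarrier H \<Longrightarrow> hnorm H (B x) \<le> b * hnorm H x"
    using bounded_operator_bound[OF A] bounded_operator_bound[OF B] by metis
  have "hnorm H (A x - B x) \<le> (a + b) * hnorm H x" if "x \<in> hcarrier H" for x
    using a[OF that] b[OF that] bounded_operatorD(1)[OF A that] bounded_operatorD(1)[OF B that]
      hnorm_diff_le[of "A x" "B x"] by (simp add: distrib_right)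
  then show ?thesis
    using bounded_operatorD[OF A] bounded_operatorD[OF B]
    unfolding bounded_operator_def by (auto simp: scale_right_diff_distrib)
qed

lemma adjoint_pair_compose:
  assumes "adjoint_pair H A A'" "adjoint_pair H B B'"
  shows "adjoint_pair H (\<lambda>x. A (B x)) (\<lambda>x. B' (A' x))"
  unfolding adjoint_pair_def
  using adjoint_pairD[OF assms(1)] adjoint_pairD[OF assms(2)]
  by (simp add: bounded_operator_compose bounded_operatorD(1))

lemma adjoint_pair_diff:
  assumes "adjoint_pair H A A'" "adjoint_pair H B B'"
  shows "adjoint_pair H (\<lambda>x. A x - B x) (\<lambda>x. A' x - B' x)"
  unfolding adjoint_pair_def
  using adjoint_pairD[OF assms(1)] adjoint_pairD[OF assms(2)]
  by (simp add: bounded_operator_diff bounded_operatorD(1) inner_diff_left inner_diff_right)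

lemma bounded_operator_cong:
  assumes "bounded_operator H A" "\<And>x. x \<in> hcarrier H \<Longrightarrow> A x = B x"
  shows "bounded_operator H B"
  using assms unfolding bounded_operator_def by (auto simp: Pi_iff)

lemma adjoint_pair_add:
  assumes A: "adjoint_pair H A A'" and B: "adjoint_pair H B B'"
  shows "adjoint_pair H (\<lambda>x. A x + B x) (\<lambda>x. A' x + B' x)"
proof -
  have zero: "adjoint_pair H (\<lambda>x. 0) (\<lambda>x. 0)"
    using hnorm_eq_zero_iff[of 0]
    by (auto simp: adjoint_pair_def bounded_operator_def intro!: exI[of _ 0])
  \<comment> \<open>A sum is written as a difference, so that closure under differences
    suffices.\<close>
  have "adjoint_pair H (\<lambda>x. A x - (0 - B x)) (\<lambda>x. A' x - (0 - B' x))"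
    by (intro adjoint_pair_diff A B zero)
  then show ?thesis by simp
qed

lemma adjoint_pair_cong:
  assumes "adjoint_pair H A A'" "\<And>x. x \<in> hcarrier H \<Longrightarrow> A x = B x"
    "\<And>x. x \<in> hcarrier H \<Longrightarrow> A' x = B' x"
  shows "adjoint_pair H B B'"
  using assms bounded_operator_cong[of A B] bounded_operator_cong[of A' B']
  unfolding adjoint_pair_def by auto

lemma self_commutator_eq:
  assumes "adjoint_pair H A B" "x \<in> hcarrier H"
  shows "self_commutator H A x = B (A x) - A (B x)"
  using assms by (simp add: self_commutator_def adjoint_op_eq[OF assms(1)]
      bounded_operatorD(1)[OF adjoint_pairD(1)[OF assms(1)]])

lemma adjoint_pair_self_commutator:
  assumes "adjoint_pair H A B"
  shows "adjoint_pair H (self_commutator H A) (self_commutator H A)"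
proof (rule adjoint_pair_cong)
  show "adjoint_pair H (\<lambda>x. B (A x) - A (B x)) (\<lambda>x. B (A x) - A (B x))"
    by (rule adjoint_pair_diff[OF adjoint_pair_compose[OF adjoint_pair_sym[OF assms] assms]
          adjoint_pair_compose[OF assms adjoint_pair_sym[OF assms]]])
qed (simp_all add: self_commutator_eq[OF assms])

section \<open>Positive operators and lower bounds for the trace\<close>

lemma positive_imp_symmetric:
  assumes P: "positive_semidefinite H P" and x: "x \<in> hcarrier H" and y: "y \<in> hcarrier H"
  shows "hinner H (P x) y = hinner H x (P y)"
proof -
  have bP: "bounded_operator H P" using P by (simp add: positive_semidefinite_def)
  note [simp] = bounded_operatorD[OF bP]
  have re: "Im (hinner H (P v) v) = 0" if "v \<in> hcarrier H" for v
    using P that by (auto simp: positive_semidefinite_def complex_is_Real_iff)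
  have exp: "hinner H (P (x + hscale H c y)) (x + hscale H c y)
     = hinner H (P x) x + (cmod c)\<^sup>2 * hinner H (P y) y
       + cnj c * hinner H (P x) y + c * hinner H (P y) x" for c
    using x y unfolding complex_norm_square
    by (simp add: inner_add_left inner_add_right inner_scale_left inner_scale_right algebra_simps)
  \<comment> \<open>Polarization: the form is real at \<open>x\<close>, at \<open>y\<close> and at
    every \<open>x + c y\<close>, so the cross terms are real too. Taking \<open>c = 1\<close>
    compares imaginary parts, \<open>c = \<i>\<close> real parts.\<close>
  have *: "Im (cnj c * hinner H (P x) y + c * hinner H (P y) x) = 0" for c
    using exp[of c] re[of "x + hscale H c y"] re[of x] re[of y] x y
    by (simp add: complex_eq_iff)
  have "hinner H (P x) y = cnj (hinner H (P y) x)"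
    using *[of 1] *[of \<i>] by (simp add: complex_eq_iff)
  then show ?thesis using inner_commute[of x "P y"] x y by simp
qed

text \<open>Since \<open>(P + l) (P - l) u = 0\<close>, the vector \<open>y = (P - l) u\<close>
  satisfies \<open>P y = - l y\<close>, and positivity of \<open>P\<close> forces
  \<open>y = 0\<close>. This evaluates every modulus on an eigenvector of \<open>A\<^sup>*A\<close>
  without appeal to uniqueness of square roots.\<close>

lemma modulus_eigenvector:
  assumes P: "positive_semidefinite H P" and u: "u \<in> hcarrier H"
    and PP: "P (P u) = hscale H (complex_of_real (l\<^sup>2)) u" and l: "l > 0"
  shows "P u = hscale H (complex_of_real l) u"
proof -
  have bP: "bounded_operator H P" using P by (simp add: positive_semidefinite_def)
  define y where "y = P u - hscale H (complex_of_real l) u"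
  have y: "y \<in> hcarrier H" unfolding y_def using u by (simp add: bounded_operatorD[OF bP])
  have "P y = P (P u) - hscale H (complex_of_real l) (P u)"
    using bounded_operatorD(2)[OF bP, of y "hscale H (complex_of_real l) u"] y u
    by (simp add: y_def bounded_operatorD[OF bP] algebra_simps)
  also have "\<dots> = hscale H (- complex_of_real l) y"
    by (simp add: PP y_def scale_right_diff_distrib power2_eq_square)
  finally have Py: "P y = hscale H (- complex_of_real l) y" .
  have "0 \<le> Re (hinner H (P y) y)" using P y by (simp add: positive_semidefinite_def)
  also have "\<dots> = - l * (hnorm H y)\<^sup>2"
    unfolding Py inner_scale_left[OF y y] using y by (simp add: hnorm_sq)
  finally have "(hnorm H y)\<^sup>2 \<le> 0" using l by (simp add: zero_le_mult_iff mult_le_0_iff)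
  then have "y = 0" using hnorm_eq_zero_iff y by simp
  then show ?thesis by (simp add: y_def)
qed

text \<open>Split \<open>x = p + y\<close> with \<open>p\<close> the projection onto the span of the
  \<open>u k\<close>. That span is invariant under \<open>P\<close>, so the cross terms vanish, and
  the contribution of \<open>y\<close> is nonnegative.\<close>

lemma positive_ge_eigenvectors:
  assumes P: "positive_semidefinite H P" and F: "finite F"
    and u: "\<And>k. k \<in> F \<Longrightarrow> u k \<in> hcarrier H"
    and on: "\<And>k l. \<lbrakk>k \<in> F; l \<in> F\<rbrakk> \<Longrightarrow> hinner H (u k) (u l) = (if k = l then 1 else 0)"
    and eig: "\<And>k. k \<in> F \<Longrightarrow> P (u k) = hscale H (complex_of_real (l k)) (u k)"
    and x: "x \<in> hcarrier H"
  shows "(\<Sum>k\<in>F. l k * (cmod (hinner H x (u k)))\<^sup>2) \<le> Re (hinner H (P x) x)"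
proof -
  have bP: "bounded_operator H P" using P by (simp add: positive_semidefinite_def)
  define c where "c k = hinner H x (u k)" for k
  define p where "p = (\<Sum>k\<in>F. hscale H (c k) (u k))"
  have p: "p \<in> hcarrier H" unfolding p_def by (rule sum_closed) (simp add: u)
  define y where "y = x - p"
  have y: "y \<in> hcarrier H" using x p by (simp add: y_def)
  have pu: "hinner H p (u k) = c k" if "k \<in> F" for k
  proof -
    have "hinner H p (u k) = (\<Sum>j\<in>F. c j * (if j = k then 1 else 0))"
      unfolding p_def using that u by (simp add: inner_sum_left inner_scale_left on)
    then show ?thesis using that F by (simp add: if_distrib cong: if_cong)
  qed
  have yu: "hinner H y (u k) = 0" if "k \<in> F" for k
    using pu[OF that] x p u[OF that] by (simp add: y_def inner_diff_left c_def)
  have Pp: "hinner H (P p) v = (\<Sum>k\<in>F. c k * l k * hinner H (u k) v)" if v: "v \<in> hcarrier H" for v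
  proof -
    have "hinner H (P p) v = hinner H p (P v)"
      using positive_imp_symmetric[OF P p v] .
    also have "\<dots> = (\<Sum>k\<in>F. c k * hinner H (P (u k)) v)"
      unfolding p_def using u v
      by (simp add: inner_sum_left inner_scale_left positive_imp_symmetric[OF P] bounded_operatorD[OF bP])
    also have "\<dots> = (\<Sum>k\<in>F. c k * l k * hinner H (u k) v)"
      by (rule sum.cong) (auto simp: eig u v inner_scale_left)
    finally show ?thesis .
  qed
  have Ppy: "hinner H (P p) y = 0"
  proof -
    have "hinner H (u k) y = 0" if "k \<in> F" for k
      using yu[OF that] inner_commute[OF u[OF that] y] by simp
    then show ?thesis using Pp[OF y] by simp
  qed
  have Ppp: "hinner H (P p) p = (\<Sum>k\<in>F. l k * (cmod (c k))\<^sup>2)"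
  proof -
    have "hinner H (u k) p = cnj (c k)" if "k \<in> F" for k
      using pu[OF that] inner_commute[OF u[OF that] p] by simp
    then have "hinner H (P p) p = (\<Sum>k\<in>F. c k * l k * cnj (c k))"
      using Pp[OF p] by simp
    then show ?thesis by (simp add: complex_norm_square mult.commute mult.left_commute del: of_real_power)
  qed
  have "P x = P p + P y" using bounded_operatorD(2)[OF bP p y] by (simp add: y_def)
  moreover have "x = p + y" by (simp add: y_def)
  ultimately have "hinner H (P x) x = hinner H (P p + P y) (p + y)" by simp
  also have "\<dots> = hinner H (P p) p + hinner H (P p) y + hinner H (P y) p + hinner H (P y) y"
    using p y by (simp add: inner_add_left inner_add_right bounded_operatorD[OF bP])
  also have "hinner H (P y) p = cnj (hinner H (P p) y)"
    using positive_imp_symmetric[OF P y p] inner_commute[of y "P p"] p y by (simp add: bounded_operatorD[OF bP])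
  finally have "Re (hinner H (P x) x) = (\<Sum>k\<in>F. l k * (cmod (c k))\<^sup>2) + Re (hinner H (P y) y)"
    by (simp add: Ppy Ppp)
  then show ?thesis
    using P y by (simp add: positive_semidefinite_def c_def)
qed

text \<open>The lower half of Parseval's identity, from bare density of the span: the projection
  \<open>p\<close> of \<open>u\<close> onto the first \<open>N\<close> basis vectors is at least as
  close to \<open>u\<close> as any combination \<open>y\<close> of them.\<close>

lemma orthonormal_partial_sum_ge:
  assumes e: "orthonormal_basis H e" and u: "u \<in> hcarrier H" and un: "hinner H u u = 1" and t: "t < 1"
  shows "\<exists>N. t \<le> (\<Sum>n<N. (cmod (hinner H (e n) u))\<^sup>2)"
proof -
  have ec: "e n \<in> hcarrier H" for n using e by (auto simp: orthonormal_basis_def)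
  have on: "hinner H (e m) (e n) = (if m = n then 1 else 0)" for m n
    using e by (auto simp: orthonormal_basis_def)
  have "u \<in> mtopology closure_of (span (range e))"
    using e u by (simp add: orthonormal_basis_def htopology_def)
  moreover define r where "r = sqrt (1 - t)"
  moreover have "r > 0" using t by (simp add: r_def)
  ultimately obtain y where y: "y \<in> span (range e)" "y \<in> mball u r"
    unfolding metric_closure_of by blast
  have yc: "y \<in> hcarrier H" using y(2) by simp
  have dist: "hnorm H (u - y) < r" using y(2) u by (simp add: hdist_def split: if_splits)
  obtain S g where S: "finite S" "S \<subseteq> range e" "y = (\<Sum>a\<in>S. hscale H (g a) a)"
    using y(1) unfolding span_explicit by blast
  obtain I where I: "finite I" "S = e ` I" using S(1,2) by (metis finite_subset_image subset_UNIV)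
  obtain N where N: "I \<subseteq> {..<N}" using finite_nat_bounded[OF I(1)] by auto
  define c where "c n = hinner H u (e n)" for n
  define p where "p = (\<Sum>n<N. hscale H (c n) (e n))"
  have p: "p \<in> hcarrier H" unfolding p_def by (rule sum_closed) (simp add: ec)
  define z where "z = u - p"
  have z: "z \<in> hcarrier H" using u p by (simp add: z_def)
  have ze: "hinner H z (e n) = 0" if "n < N" for n
  proof -
    have "hinner H p (e n) = (\<Sum>j<N. c j * (if j = n then 1 else 0))"
      unfolding p_def by (simp add: inner_sum_left inner_scale_left on ec)
    also have "\<dots> = c n" using that by (simp add: if_distrib cong: if_cong)
    finally show ?thesis using u p ec by (simp add: z_def inner_diff_left c_def)
  qed
  have zp: "hinner H z p = 0"
    unfolding p_def using z ec by (simp add: inner_sum_right inner_scale_right ze)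
  have zy: "hinner H z y = 0"
    unfolding S(3) using z ec I N ze
    by (subst inner_sum_right) (auto simp: inner_scale_right intro!: sum.neutral)
  \<comment> \<open>\<open>z\<close> is orthogonal to \<open>p\<close> and to \<open>y\<close>; by
    Cauchy-Schwarz it is therefore no longer than \<open>u - y\<close>.\<close>
  have "hinner H z (u - y) = hinner H z z"
  proof -
    have "u - y = (z + p) - y" by (simp add: z_def)
    then show ?thesis using z p yc zp zy by (simp add: inner_diff_right inner_add_right)
  qed
  then have "(hnorm H z)\<^sup>2 \<le> hnorm H z * hnorm H (u - y)"
    using cauchy_schwarz[of z "u - y"] complex_Re_le_cmod[of "hinner H z z"] z u yc
    by (simp add: hnorm_sq)
  then have "hnorm H z \<le> hnorm H (u - y)"
    using hnorm_ge_zero[OF z] hnorm_ge_zero[of "u - y"] u yc by (cases "hnorm H z = 0") (auto simp: power2_eq_square)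
  then have "hnorm H z < r" using dist by simp
  then have zr: "(hnorm H z)\<^sup>2 < 1 - t"
    using hnorm_ge_zero[OF z] t by (metis r_def real_sqrt_less_iff real_sqrt_unique)
  have "hinner H u u = hinner H z u + hinner H p u"
    using z p u inner_add_left[of z p u] by (simp add: z_def)
  moreover have "hinner H z u = hinner H z z"
    using inner_add_right[of z p z] z p zp by (simp add: z_def)
  moreover have "hinner H p u = (\<Sum>n<N. (cmod (c n))\<^sup>2)"
  proof -
    have "hinner H (e n) u = cnj (c n)" for n using inner_commute[of "e n" u] ec u by (simp add: c_def)
    then have "hinner H p u = (\<Sum>n<N. c n * cnj (c n))"
      unfolding p_def using ec u by (simp add: inner_sum_left inner_scale_left)
    then show ?thesis by (simp add: complex_norm_square del: of_real_power)
  qed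
  ultimately have "1 = (hnorm H z)\<^sup>2 + (\<Sum>n<N. (cmod (c n))\<^sup>2)"
    using un z by (simp add: hnorm_sq complex_eq_iff)
  moreover have "cmod (c n) = cmod (hinner H (e n) u)" for n
    using inner_commute[of u "e n"] ec u by (simp add: c_def)
  ultimately show ?thesis using zr by (intro exI[of _ N]) simp
qed

text \<open>\<open>trace_class\<close> is existential in the modulus and the basis, so all choices
  must be refuted. Every modulus has eigenvalue \<open>l k\<close> at \<open>u k\<close>, and the
  diagonal sum in any basis dominates a fixed fraction of each partial sum of
  \<open>l\<close>.\<close>

lemma not_trace_classI:
  fixes u :: "nat \<Rightarrow> 'a"
  assumes u: "\<And>k. u k \<in> hcarrier H"
    and on: "\<And>k l. hinner H (u k) (u l) = (if k = l then 1 else 0)"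
    and eig: "\<And>k. adjoint_op H C (C (u k)) = hscale H (complex_of_real ((l k)\<^sup>2)) (u k)"
    and l: "\<And>k. l k > 0" and ns: "\<not> summable l"
  shows "\<not> trace_class H C"
proof
  assume "trace_class H C"
  then obtain P e where P: "positive_semidefinite H P"
    and PP: "\<And>x. x \<in> hcarrier H \<Longrightarrow> P (P x) = adjoint_op H C (C x)"
    and e: "orthonormal_basis H e" and sm: "summable (\<lambda>n. Re (hinner H (P (e n)) (e n)))"
    unfolding trace_class_def is_modulus_def by blast
  have ec: "e n \<in> hcarrier H" for n using e by (auto simp: orthonormal_basis_def)
  have pos: "0 \<le> Re (hinner H (P (e n)) (e n))" for n
    using P ec by (simp add: positive_semidefinite_def)
  define S where "S = (\<Sum>n. Re (hinner H (P (e n)) (e n)))"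
  have Pu: "P (u k) = hscale H (complex_of_real (l k)) (u k)" for k
    using modulus_eigenvector[OF P u _ l] PP[OF u] eig by simp
  have "sum l {..<m} \<le> 2 * S" for m
  proof -
    \<comment> \<open>Asking only for half of the squared norm of each \<open>u k\<close> lets
      finitely many basis vectors serve the first \<open>m\<close> of them at once; the price is the
      factor \<open>2\<close> before \<open>S\<close>.\<close>
    have "\<forall>k. \<exists>N. 1/2 \<le> (\<Sum>n<N. (cmod (hinner H (e n) (u k)))\<^sup>2)"
      by (intro allI orthonormal_partial_sum_ge[OF e u]) (simp_all add: on)
    then obtain N where N: "\<And>k. 1/2 \<le> (\<Sum>n<N k. (cmod (hinner H (e n) (u k)))\<^sup>2)" by metis
    define M where "M = (\<Sum>k<m. N k)"
    have NM: "N k \<le> M" if "k < m" for k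
      unfolding M_def using that by (intro member_le_sum) auto
    have "sum l {..<m} / 2 = (\<Sum>k<m. l k * (1/2))" by (simp add: sum_divide_distrib)
    also have "\<dots> \<le> (\<Sum>k<m. l k * (\<Sum>n<M. (cmod (hinner H (e n) (u k)))\<^sup>2))"
    proof (rule sum_mono)
      fix k assume "k \<in> {..<m}"
      then have "1/2 \<le> (\<Sum>n<M. (cmod (hinner H (e n) (u k)))\<^sup>2)"
        using NM[of k] by (intro order_trans[OF N[of k] sum_mono2]) auto
      then show "l k * (1/2) \<le> l k * (\<Sum>n<M. (cmod (hinner H (e n) (u k)))\<^sup>2)"
        using l[of k] by (intro mult_left_mono) auto
    qed
    also have "\<dots> = (\<Sum>n<M. \<Sum>k<m. l k * (cmod (hinner H (e n) (u k)))\<^sup>2)"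
      by (simp add: sum_distrib_left) (rule sum.swap)
    also have "\<dots> \<le> (\<Sum>n<M. Re (hinner H (P (e n)) (e n)))"
      by (intro sum_mono positive_ge_eigenvectors[OF P]) (auto simp: u on Pu ec)
    also have "\<dots> \<le> S" unfolding S_def by (rule sum_le_suminf[OF sm]) (auto simp: pos)
    finally show ?thesis by simp
  qed
  then have "summable l" using l by (intro summableI_nonneg_bounded) (auto intro: less_imp_le)
  then show False using ns by simp
qed

end

section \<open>The space of square-summable sequences\<close>

text \<open>Sums are unconditional (\<open>summable_on\<close>, \<open>infsum\<close>), so that they
  can be reindexed along partial injections of the indices.\<close>

definition ell2 :: "(nat \<Rightarrow> complex) hspace" where
  "ell2 = \<lparr>hcarrier = {x. (\<lambda>n. (cmod (x n))\<^sup>2) summable_on UNIV},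
     hscale = (\<lambda>c x n. c * x n), hinner = (\<lambda>x y. \<Sum>\<^sub>\<infinity>n. x n * cnj (y n))\<rparr>"

lemma ell2_carrier: "x \<in> hcarrier ell2 \<longleftrightarrow> (\<lambda>n. (cmod (x n))\<^sup>2) summable_on UNIV"
  by (simp add: ell2_def)

lemma ell2_scale: "hscale ell2 c x = (\<lambda>n. c * x n)"
  by (simp add: ell2_def)

lemma ell2_inner: "hinner ell2 x y = (\<Sum>\<^sub>\<infinity>n. x n * cnj (y n))"
  by (simp add: ell2_def)

lemma ell2_prod_summable:
  assumes "x \<in> hcarrier ell2" "y \<in> hcarrier ell2"
  shows "(\<lambda>n. x n * cnj (y n)) summable_on UNIV"
proof (rule Infinite_Sum.abs_summable_summable, rule Infinite_Sum.abs_summable_on_comparison_test')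
  show "(\<lambda>n. (cmod (x n))\<^sup>2 + (cmod (y n))\<^sup>2) summable_on UNIV"
    using assms by (intro summable_on_add) (auto simp: ell2_carrier)
  show "norm (x n * cnj (y n)) \<le> (cmod (x n))\<^sup>2 + (cmod (y n))\<^sup>2" for n
  proof -
    have "0 \<le> cmod (x n) * cmod (y n)" by simp
    then show ?thesis
      using sum_squares_bound[of "cmod (x n)" "cmod (y n)"]
      unfolding norm_mult complex_mod_cnj by linarith
  qed
qed

lemma ell2_inner_self:
  assumes "x \<in> hcarrier ell2"
  shows "hinner ell2 x x = complex_of_real (\<Sum>\<^sub>\<infinity>n. (cmod (x n))\<^sup>2)"
proof -
  have "((\<lambda>n. complex_of_real ((cmod (x n))\<^sup>2)) has_sum complex_of_real (\<Sum>\<^sub>\<infinity>n. (cmod (x n))\<^sup>2)) UNIV"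
    using assms unfolding ell2_carrier by (intro has_sum_of_real has_sum_infsum)
  then show ?thesis
    unfolding ell2_inner complex_norm_square[symmetric] by (rule infsumI)
qed

lemma ell2_add_carrier:
  assumes "x \<in> hcarrier ell2" "y \<in> hcarrier ell2"
  shows "x + y \<in> hcarrier ell2"
  unfolding ell2_carrier
proof (rule summable_on_comparison_test)
  show "(\<lambda>n. 2 * (cmod (x n))\<^sup>2 + 2 * (cmod (y n))\<^sup>2) summable_on UNIV"
    using assms by (intro summable_on_add summable_on_cmult_right) (auto simp: ell2_carrier)
  show "(cmod ((x + y) n))\<^sup>2 \<le> 2 * (cmod (x n))\<^sup>2 + 2 * (cmod (y n))\<^sup>2" for n
  proof -
    have "(cmod (x n + y n))\<^sup>2 \<le> (cmod (x n) + cmod (y n))\<^sup>2"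
      by (intro power_mono norm_triangle_ineq) auto
    also have "\<dots> \<le> 2 * (cmod (x n))\<^sup>2 + 2 * (cmod (y n))\<^sup>2"
      using sum_squares_bound[of "cmod (x n)" "cmod (y n)"] by (simp add: power2_sum)
    finally show ?thesis by simp
  qed
qed auto

interpretation ell2: complex_inner_product_space ell2
proof unfold_locales
  show "hscale ell2 a (x + y) = hscale ell2 a x + hscale ell2 a y" for a x y
    by (auto simp: ell2_scale algebra_simps)
  show "hscale ell2 (a + b) x = hscale ell2 a x + hscale ell2 b x" for a b x
    by (auto simp: ell2_scale algebra_simps)
  show "hscale ell2 a (hscale ell2 b x) = hscale ell2 (a * b) x" for a b x
    by (auto simp: ell2_scale algebra_simps)
  show "hscale ell2 1 x = x" for x
    by (auto simp: ell2_scale)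
  then interpret module "hscale ell2"
    by unfold_locales (auto simp: ell2_scale algebra_simps)
  show "subspace (hcarrier ell2)"
    unfolding subspace_def
    by (auto intro: ell2_add_carrier)
      (auto simp: ell2_carrier ell2_scale norm_mult power_mult_distrib intro: summable_on_cmult_right)
next
  fix x y z assume "x \<in> hcarrier ell2" "y \<in> hcarrier ell2" "z \<in> hcarrier ell2"
  then show "hinner ell2 (x + y) z = hinner ell2 x z + hinner ell2 y z"
    unfolding ell2_inner
    by (simp add: infsum_add[symmetric] ell2_prod_summable distrib_right)
next
  fix x y c assume "x \<in> hcarrier ell2" "y \<in> hcarrier ell2"
  then show "hinner ell2 (hscale ell2 c x) y = c * hinner ell2 x y"
    unfolding ell2_inner ell2_scale
    by (simp add: infsum_cmult_right'[symmetric] mult.assoc)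
next
  fix x y assume "x \<in> hcarrier ell2" "y \<in> hcarrier ell2"
  show "hinner ell2 x y = cnj (hinner ell2 y x)"
    unfolding ell2_inner infsum_cnj[symmetric] by (simp add: mult.commute)
next
  fix x assume x: "x \<in> hcarrier ell2"
  show "0 \<le> Re (hinner ell2 x x)"
    by (simp add: ell2_inner_self[OF x] infsum_nonneg)
next
  fix x assume x: "x \<in> hcarrier ell2" and "hinner ell2 x x = 0"
  then have 0: "(\<Sum>\<^sub>\<infinity>n. (cmod (x n))\<^sup>2) = 0"
    using ell2_inner_self[OF x] by simp
  have "(cmod (x n))\<^sup>2 = 0" for n
    using x 0 by (intro nonneg_infsum_le_0D[of "\<lambda>n. (cmod (x n))\<^sup>2" UNIV]) (auto simp: ell2_carrier)
  then show "x = 0" by auto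
qed

lemma ell2_hnorm_sq:
  assumes "x \<in> hcarrier ell2"
  shows "(hnorm ell2 x)\<^sup>2 = (\<Sum>\<^sub>\<infinity>n. (cmod (x n))\<^sup>2)"
  using ell2.hnorm_sq[OF assms] ell2_inner_self[OF assms] by simp

section \<open>Unit sequences, coordinatewise limits and completeness\<close>

lemma sum_fun_apply: "sum f A x = (\<Sum>a\<in>A. f a x)"
  for f :: "'a \<Rightarrow> 'b \<Rightarrow> 'c::comm_monoid_add"
  by (induction A rule: infinite_finite_induct) auto

definition unit_seq :: "nat \<Rightarrow> nat \<Rightarrow> complex" where
  "unit_seq m = (\<lambda>n. if n = m then 1 else 0)"

lemma unit_seq_apply: "unit_seq m n = (if n = m then 1 else 0)"
  by (simp add: unit_seq_def)

lemma ell2_finite_support: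
  assumes "finite F" "\<And>n. n \<notin> F \<Longrightarrow> x n = 0"
  shows "x \<in> hcarrier ell2" "(hnorm ell2 x)\<^sup>2 = (\<Sum>n\<in>F. (cmod (x n))\<^sup>2)"
proof -
  show c: "x \<in> hcarrier ell2"
    unfolding ell2_carrier using assms summable_on_cong_neutral[of UNIV F "\<lambda>n. (cmod (x n))\<^sup>2" "\<lambda>n. (cmod (x n))\<^sup>2"]
    by auto
  have "(\<Sum>\<^sub>\<infinity>n. (cmod (x n))\<^sup>2) = (\<Sum>\<^sub>\<infinity>n\<in>F. (cmod (x n))\<^sup>2)"
    using assms by (intro infsum_cong_neutral) auto
  then show "(hnorm ell2 x)\<^sup>2 = (\<Sum>n\<in>F. (cmod (x n))\<^sup>2)"
    using ell2_hnorm_sq[OF c] assms by simp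
qed

lemma unit_seq_carrier [simp]: "unit_seq m \<in> hcarrier ell2"
  by (rule ell2_finite_support(1)[of "{m}"]) (auto simp: unit_seq_apply)

lemma ell2_inner_unit_seq: "hinner ell2 x (unit_seq m) = x m"
proof -
  have "(\<Sum>\<^sub>\<infinity>n. x n * cnj (unit_seq m n)) = (\<Sum>\<^sub>\<infinity>n\<in>{m}. x n * cnj (unit_seq m n))"
    by (intro infsum_cong_neutral) (auto simp: unit_seq_apply)
  then show ?thesis by (simp add: ell2_inner unit_seq_apply)
qed

lemma hnorm_unit_seq: "hnorm ell2 (unit_seq m) = 1"
  by (simp add: hnorm_def ell2_inner_unit_seq) (simp add: unit_seq_apply)

lemma ell2_coordinate_le:
  assumes "x \<in> hcarrier ell2"
  shows "cmod (x m) \<le> hnorm ell2 x"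
  using ell2.cauchy_schwarz[OF assms unit_seq_carrier, of m]
  by (simp add: ell2_inner_unit_seq hnorm_unit_seq)

text \<open>A form of Fatou's lemma: the bound passes to every finite partial sum of squares, hence
  to the whole sum. It serves both completeness and compactness.\<close>

lemma ell2_coordinatewise_limit:
  assumes X: "\<And>n. X n \<in> hcarrier ell2"
    and B: "\<forall>\<^sub>F n in sequentially. hnorm ell2 (X n) \<le> B" "0 \<le> B"
    and lim: "\<And>i. (\<lambda>n. X n i) \<longlonglongrightarrow> y i"
  shows "y \<in> hcarrier ell2" "hnorm ell2 y \<le> B"
proof -
  have fin: "(\<Sum>i\<in>F. (cmod (y i))\<^sup>2) \<le> B\<^sup>2" if "finite F" for F
  proof (rule tendsto_upperbound)
    show "(\<lambda>n. \<Sum>i\<in>F. (cmod (X n i))\<^sup>2) \<longlonglongrightarrow> (\<Sum>i\<in>F. (cmod (y i))\<^sup>2)"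
      by (intro tendsto_intros lim)
    show "\<forall>\<^sub>F n in sequentially. (\<Sum>i\<in>F. (cmod (X n i))\<^sup>2) \<le> B\<^sup>2"
      using B(1)
    proof eventually_elim
      case (elim n)
      have "(\<Sum>i\<in>F. (cmod (X n i))\<^sup>2) \<le> (hnorm ell2 (X n))\<^sup>2"
        unfolding ell2_hnorm_sq[OF X] using that X[of n]
        by (intro finite_sum_le_infsum) (auto simp: ell2_carrier)
      also have "\<dots> \<le> B\<^sup>2" using elim ell2.hnorm_ge_zero[OF X] by (intro power_mono) auto
      finally show ?case .
    qed
  qed simp
  show y: "y \<in> hcarrier ell2"
    unfolding ell2_carrier using fin by (intro nonneg_bdd_above_summable_on) (auto intro!: bdd_aboveI)
  have "(hnorm ell2 y)\<^sup>2 \<le> B\<^sup>2"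
    unfolding ell2_hnorm_sq[OF y] using y fin by (intro infsum_le_finite_sums) (auto simp: ell2_carrier)
  then show "hnorm ell2 y \<le> B" using B(2) by (rule power2_le_imp_le)
qed

lemma ell2_complete: "ell2.mcomplete"
  unfolding ell2.mcomplete_def
proof (intro allI impI)
  fix X assume C: "ell2.MCauchy X"
  then have X: "X n \<in> hcarrier ell2" for n by (auto simp: ell2.MCauchy_def)
  have N: "\<exists>N. \<forall>m n. N \<le> m \<longrightarrow> N \<le> n \<longrightarrow> hnorm ell2 (X m - X n) < e" if "e > 0" for e
    using C that X by (auto simp: ell2.MCauchy_def hdist_def)
  have "Cauchy (\<lambda>n. X n i)" for i
  proof (rule CauchyI)
    fix e :: real assume "e > 0"
    then obtain M where M: "\<And>m n. \<lbrakk>M \<le> m; M \<le> n\<rbrakk> \<Longrightarrow> hnorm ell2 (X m - X n) < e" using N by blast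
    have "norm (X m i - X n i) < e" if "M \<le> m" "M \<le> n" for m n
      using ell2_coordinate_le[of "X m - X n" i] M[OF that] X by simp
    then show "\<exists>M. \<forall>m\<ge>M. \<forall>n\<ge>M. norm (X m i - X n i) < e" by blast
  qed
  then have "\<forall>i. \<exists>l. (\<lambda>n. X n i) \<longlonglongrightarrow> l" using Cauchy_convergent convergent_def by blast
  then obtain y where y: "\<And>i. (\<lambda>n. X n i) \<longlonglongrightarrow> y i" by metis
  \<comment> \<open>Letting \<open>n\<close> tend to infinity with \<open>m\<close> fixed turns the
    Cauchy estimate into one for \<open>X m - y\<close>; as \<open>X m\<close> lies in the space, so
    does \<open>y\<close>.\<close>
  have est: "X m - y \<in> hcarrier ell2 \<and> hnorm ell2 (X m - y) \<le> e"
    if "e > 0" "\<And>n. m \<le> n \<Longrightarrow> hnorm ell2 (X m - X n) < e" for m e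
  proof -
    have "\<forall>\<^sub>F n in sequentially. hnorm ell2 (X m - X n) \<le> e"
      using that(2) by (intro eventually_sequentiallyI[of m]) (simp add: less_imp_le)
    moreover have "(\<lambda>n. (X m - X n) i) \<longlonglongrightarrow> (X m - y) i" for i
      by (auto intro!: tendsto_intros y)
    ultimately show ?thesis
      using ell2_coordinatewise_limit[of "\<lambda>n. X m - X n" e "X m - y"] X that(1) by auto
  qed
  obtain M where "\<And>n. M \<le> n \<Longrightarrow> hnorm ell2 (X M - X n) < 1" using N[of 1] by auto
  then have "X M - y \<in> hcarrier ell2" using est[of 1 M] by simp
  then have "X M - (X M - y) \<in> hcarrier ell2" using X by blast
  then have yc: "y \<in> hcarrier ell2" by simp
  have "\<exists>N. \<forall>n\<ge>N. X n \<in> hcarrier ell2 \<and> hdist ell2 (X n) y < e" if "e > 0" for e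
  proof -
    obtain M where M: "\<And>m n. \<lbrakk>M \<le> m; M \<le> n\<rbrakk> \<Longrightarrow> hnorm ell2 (X m - X n) < e/2"
      using N[of "e/2"] \<open>e > 0\<close> by auto
    have "hnorm ell2 (X m - y) \<le> e/2" if "M \<le> m" for m
      using est[of "e/2" m] M that \<open>e > 0\<close> by auto
    then show ?thesis using X yc \<open>e > 0\<close> by (intro exI[of _ M]) (force simp: hdist_def)
  qed
  then show "\<exists>x. limitin ell2.mtopology X x sequentially"
    using yc by (auto simp: ell2.limit_metric_sequentially intro!: exI[of _ y])
qed

lemma ell2_hilbert: "complex_hilbert_space ell2"
  by unfold_locales (rule ell2_complete)

section \<open>Density, dimension and separability\<close>

lemma ell2_truncation:
  assumes x: "x \<in> hcarrier ell2" and e: "e > 0"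
  shows "\<exists>N. \<forall>F. finite F \<longrightarrow> {..<N} \<subseteq> F \<longrightarrow> hnorm ell2 (x - (\<lambda>n. if n \<in> F then x n else 0)) < e"
proof -
  define s where "s = (\<lambda>n. (cmod (x n))\<^sup>2)"
  have sm: "s summable_on UNIV" using x by (simp add: s_def ell2_carrier)
  have "\<forall>\<^sub>F F in finite_subsets_at_top UNIV. dist (sum s F) (infsum s UNIV) < e\<^sup>2"
    using has_sum_infsum[OF sm] e unfolding has_sum_def by (intro tendstoD) auto
  then obtain G where G: "finite G" "\<And>F. \<lbrakk>finite F; G \<subseteq> F\<rbrakk> \<Longrightarrow> dist (sum s F) (infsum s UNIV) < e\<^sup>2"
    unfolding eventually_finite_subsets_at_top by (metis subset_UNIV)
  obtain N where N: "G \<subseteq> {..<N}" using finite_nat_bounded[OF G(1)] by auto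
  have "hnorm ell2 (x - (\<lambda>n. if n \<in> F then x n else 0)) < e" if F: "finite F" "{..<N} \<subseteq> F" for F
  proof -
    define t where "t = (\<lambda>n. if n \<in> F then x n else 0)"
    have t: "t \<in> hcarrier ell2" using F by (intro ell2_finite_support(1)[of F]) (auto simp: t_def)
    have sF: "(\<lambda>n. if n \<in> F then s n else 0) summable_on UNIV"
      using summable_on_cong_neutral[of UNIV F "\<lambda>n. if n \<in> F then s n else 0" s] F by auto
    have xt: "(\<lambda>n. (cmod ((x - t) n))\<^sup>2) summable_on UNIV"
      using ell2.carrier_closed(3)[OF x t] by (simp add: ell2_carrier)
    have "infsum s UNIV = (\<Sum>\<^sub>\<infinity>n. (cmod ((x - t) n))\<^sup>2 + (if n \<in> F then s n else 0))"
      by (rule infsum_cong) (simp add: s_def t_def)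
    also have "\<dots> = (hnorm ell2 (x - t))\<^sup>2 + (\<Sum>\<^sub>\<infinity>n. if n \<in> F then s n else 0)"
      using ell2_hnorm_sq[OF ell2.carrier_closed(3)[OF x t]] by (simp only: infsum_add[OF xt sF])
    also have "(\<Sum>\<^sub>\<infinity>n. if n \<in> F then s n else 0) = (\<Sum>\<^sub>\<infinity>n\<in>F. s n)"
      by (intro infsum_cong_neutral) auto
    also have "\<dots> = sum s F" using F by simp
    finally have "(hnorm ell2 (x - t))\<^sup>2 = infsum s UNIV - sum s F" by linarith
    also have "infsum s UNIV - sum s F < e\<^sup>2"
      using G(2)[OF F(1) subset_trans[OF N F(2)]] unfolding dist_real_def by linarith
    finally show ?thesis using e unfolding t_def by (intro power_less_imp_less_base[of _ 2 e]) auto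
  qed
  then show ?thesis by blast
qed

lemma ell2_dense_span:
  assumes E: "E \<subseteq> hcarrier ell2" and un: "\<And>m. unit_seq m \<in> ell2.span E"
  shows "htopology ell2 closure_of (ell2.span E) = hcarrier ell2"
proof -
  have "\<exists>y\<in>ell2.span E. y \<in> ell2.mball x r" if x: "x \<in> hcarrier ell2" and r: "r > 0" for x r
  proof -
    obtain N where N: "\<And>F. \<lbrakk>finite F; {..<N} \<subseteq> F\<rbrakk> \<Longrightarrow> hnorm ell2 (x - (\<lambda>n. if n \<in> F then x n else 0)) < r"
      using ell2_truncation[OF x r] by blast
    define y where "y = (\<lambda>n. if n \<in> {..<N} then x n else 0)"
    have "y = (\<Sum>m<N. hscale ell2 (x m) (unit_seq m))"
      by (rule ext) (simp add: y_def ell2_scale sum_fun_apply unit_seq_apply if_distrib cong: if_cong)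
    then have "y \<in> ell2.span E"
      by (simp add: ell2.span_sum ell2.span_scale un)
    moreover have "y \<in> hcarrier ell2" by (rule ell2_finite_support(1)[of "{..<N}"]) (auto simp: y_def)
    moreover have "hnorm ell2 (x - y) < r" unfolding y_def by (rule N) auto
    ultimately show ?thesis using x by (auto simp: hdist_def)
  qed
  then show ?thesis unfolding htopology_def ell2.metric_closure_of by auto
qed

lemma ell2_infinite_dimensional: "infinite_dimensional ell2"
  unfolding infinite_dimensional_def
proof
  assume "\<exists>B. finite B \<and> ell2.span B = hcarrier ell2"
  then obtain B where B: "finite B" "ell2.span B = hcarrier ell2" by blast
  have inj: "inj unit_seq"
    by (rule injI) (metis unit_seq_apply zero_neq_one)
  have "ell2.independent (range unit_seq)"
    unfolding ell2.dependent_explicit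
  proof (rule notI)
    assume "\<exists>S u. finite S \<and> S \<subseteq> range unit_seq \<and>
      (\<Sum>v\<in>S. hscale ell2 (u v) v) = 0 \<and> (\<exists>v\<in>S. u v \<noteq> 0)"
    then obtain S u v where S: "finite S" "S \<subseteq> range unit_seq" and v: "v \<in> S" "u v \<noteq> 0"
      and 0: "(\<Sum>v\<in>S. hscale ell2 (u v) v) = 0" by blast
    obtain m where m: "v = unit_seq m" using S v by auto
    have "(\<Sum>w\<in>S. u w * w m) = (\<Sum>w\<in>S. if w = v then u v else 0)"
    proof (rule sum.cong)
      fix w assume "w \<in> S"
      then obtain k where "w = unit_seq k" using S by auto
      then show "u w * w m = (if w = v then u v else 0)"
        using inj m by (auto simp: unit_seq_apply inj_def)
    qed simp
    also have "\<dots> = u v" using S v by simp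
    finally have "(\<Sum>w\<in>S. hscale ell2 (u w) w) m = u v" by (simp add: ell2_scale sum_fun_apply)
    then show False using 0 v by simp
  qed
  moreover have "range unit_seq \<subseteq> ell2.span B" unfolding B(2) by auto
  ultimately have "finite (range unit_seq)" using ell2.independent_span_bound[OF B(1)] by metis
  then show False using inj by (simp add: finite_image_iff)
qed

lemma ell2_separable: "separable ell2"
proof -
  obtain D :: "complex set" where D: "countable D" "\<And>X. \<lbrakk>open X; X \<noteq> {}\<rbrakk> \<Longrightarrow> \<exists>d\<in>D. d \<in> X"
    using countable_dense_exists by metis
  \<comment> \<open>Finite lists over a countable dense set of scalars, padded with zeros, form the
    countable dense set.\<close>
  define C where "C = (\<lambda>xs n. if n < length xs then xs ! n else 0) ` lists D"
  have "countable C" unfolding C_def using D(1) by simp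
  moreover have Cc: "C \<subseteq> hcarrier ell2"
  proof
    fix y assume "y \<in> C"
    then obtain xs where "y = (\<lambda>n. if n < length xs then xs ! n else 0)" by (auto simp: C_def)
    then show "y \<in> hcarrier ell2" by (intro ell2_finite_support(1)[of "{..<length xs}"]) auto
  qed
  moreover have "\<exists>y\<in>C. y \<in> ell2.mball x r" if x: "x \<in> hcarrier ell2" and r: "r > 0" for x r
  proof -
    obtain N where N: "\<And>F. \<lbrakk>finite F; {..<N} \<subseteq> F\<rbrakk> \<Longrightarrow> hnorm ell2 (x - (\<lambda>n. if n \<in> F then x n else 0)) < r/2"
      using ell2_truncation[OF x, of "r/2"] r by auto
    define t where "t = (\<lambda>n. if n \<in> {..<N} then x n else 0)"
    have t: "t \<in> hcarrier ell2" by (rule ell2_finite_support(1)[of "{..<N}"]) (auto simp: t_def)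
    have xt: "hnorm ell2 (x - t) < r/2" unfolding t_def by (rule N) auto
    define d where "d = r / 2 / (real N + 1)"
    have d: "d > 0" using r by (simp add: d_def)
    have "\<exists>z\<in>D. z \<in> ball (x n) d" for n
      using D(2)[of "ball (x n) d"] d by auto
    then obtain z where z: "\<And>n. z n \<in> D" "\<And>n. z n \<in> ball (x n) d" by metis
    define y where "y = (\<lambda>n. if n < N then z n else 0)"
    have "y = (\<lambda>n. if n < length (map z [0..<N]) then map z [0..<N] ! n else 0)"
      by (auto simp: y_def)
    moreover have "map z [0..<N] \<in> lists D" using z by auto
    ultimately have yC: "y \<in> C" unfolding C_def by blast
    then have y: "y \<in> hcarrier ell2" using Cc by blast
    have "(hnorm ell2 (t - y))\<^sup>2 = (\<Sum>n<N. (cmod ((t - y) n))\<^sup>2)"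
      by (rule ell2_finite_support(2)) (auto simp: t_def y_def)
    also have "\<dots> \<le> (\<Sum>n<N. d\<^sup>2)"
      using z(2) by (intro sum_mono power_mono) (auto simp: t_def y_def dist_norm less_imp_le)
    also have "\<dots> \<le> ((real N + 1) * d)\<^sup>2"
    proof -
      have "real N \<le> (real N + 1)\<^sup>2" by (simp add: power2_eq_square algebra_simps)
      then show ?thesis using mult_right_mono[of "real N" "(real N + 1)\<^sup>2" "d\<^sup>2"]
        by (simp add: power_mult_distrib)
    qed
    also have "(real N + 1) * d = r / 2"
    proof -
      have "real N + 1 \<noteq> 0" by linarith
      then show ?thesis unfolding d_def by (rule nonzero_mult_div_cancel_left[of _ "r / 2", folded times_divide_eq_right])
    qed
    finally have "hnorm ell2 (t - y) \<le> r / 2"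
      by (rule power2_le_imp_le) (use r in simp)
    then have "hnorm ell2 (x - y) < r"
      using ell2.hnorm_triangle[of "x - t" "t - y"] xt x t y by simp
    then show ?thesis using x y yC by (auto simp: hdist_def)
  qed
  ultimately show ?thesis
    unfolding separable_def htopology_def ell2.metric_closure_of by (intro exI[of _ C]) auto
qed

section \<open>Weighted partial injections and compactness\<close>

lemma ell2_mono:
  assumes y: "y \<in> hcarrier ell2" and le: "\<And>n. cmod (x n) \<le> cmod (y n)"
  shows "x \<in> hcarrier ell2" "hnorm ell2 x \<le> hnorm ell2 y"
proof -
  show x: "x \<in> hcarrier ell2"
    unfolding ell2_carrier
    by (rule summable_on_comparison_test[OF y[unfolded ell2_carrier]]) (auto intro: power_mono le)
  have "(hnorm ell2 x)\<^sup>2 \<le> (hnorm ell2 y)\<^sup>2"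
    unfolding ell2_hnorm_sq[OF x] ell2_hnorm_sq[OF y]
    using x y by (intro infsum_mono) (auto simp: ell2_carrier intro: power_mono le)
  then show "hnorm ell2 x \<le> hnorm ell2 y"
    using ell2.hnorm_ge_zero[OF y] by (rule power2_le_imp_le)
qed

text \<open>The \<open>z r\<close> are replaced by their moduli \<open>a r\<close>: then the
  pointwise bound compares \<open>y\<close> with one single vector, and the triangle inequality is
  applied to that vector.\<close>

lemma ell2_dominated:
  assumes R: "finite R" and z: "\<And>r. r \<in> R \<Longrightarrow> z r \<in> hcarrier ell2"
    and le: "\<And>n. cmod (y n) \<le> (\<Sum>r\<in>R. cmod (z r n))"
  shows "hnorm ell2 y \<le> (\<Sum>r\<in>R. hnorm ell2 (z r))"
proof -
  define a where "a r = (\<lambda>n. complex_of_real (cmod (z r n)))" for r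
  have a: "a r \<in> hcarrier ell2 \<and> hnorm ell2 (a r) \<le> hnorm ell2 (z r)" if "r \<in> R" for r
    using ell2_mono[OF z[OF that], of "a r"] by (auto simp: a_def)
  have "sum a S \<in> hcarrier ell2 \<and> hnorm ell2 (sum a S) \<le> (\<Sum>r\<in>S. hnorm ell2 (a r))" if "S \<subseteq> R" for S
    using finite_subset[OF that R] that
  proof (induction S rule: finite_induct)
    case empty
    then show ?case
      by (metis sum.empty order_refl ell2.carrier_closed(1) ell2.hnorm_eq_zero_iff)
  next
    case (insert r S)
    then have "sum a S \<in> hcarrier ell2" "hnorm ell2 (sum a S) \<le> (\<Sum>r\<in>S. hnorm ell2 (a r))"
      and "a r \<in> hcarrier ell2"
      using a[of r] by auto
    then show ?case
      using ell2.hnorm_triangle[of "a r" "sum a S"] ell2.carrier_closed(2)[of "a r" "sum a S"]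
      unfolding sum.insert[OF insert(1,2)] by linarith
  qed
  then have s: "sum a R \<in> hcarrier ell2" "hnorm ell2 (sum a R) \<le> (\<Sum>r\<in>R. hnorm ell2 (a r))" by auto
  have "cmod (y n) \<le> cmod (sum a R n)" for n
  proof -
    have "sum a R n = complex_of_real (\<Sum>r\<in>R. cmod (z r n))" by (simp add: a_def sum_fun_apply)
    then show ?thesis using le[of n] by (simp only: norm_of_real)
  qed
  then have "hnorm ell2 y \<le> hnorm ell2 (sum a R)" by (rule ell2_mono(2)[OF s(1)])
  also have "\<dots> \<le> (\<Sum>r\<in>R. hnorm ell2 (z r))"
    using s(2) sum_mono[of R "\<lambda>r. hnorm ell2 (a r)" "\<lambda>r. hnorm ell2 (z r)"] a by auto
  finally show ?thesis .
qed

definition wcomp :: "(nat \<Rightarrow> complex) \<Rightarrow> (nat \<Rightarrow> nat) \<Rightarrow> (nat \<Rightarrow> complex) \<Rightarrow> nat \<Rightarrow> complex" where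
  "wcomp w s x = (\<lambda>n. w n * x (s n))"

text \<open>Injectivity of \<open>s\<close> is asked only on the support of \<open>w\<close>: there
  the sum of squares reindexes to a part of the sum for \<open>x\<close>.\<close>

lemma wcomp_bound:
  assumes B: "\<And>n. cmod (w n) \<le> B" and inj: "inj_on s {n. w n \<noteq> 0}" and x: "x \<in> hcarrier ell2"
  shows "wcomp w s x \<in> hcarrier ell2" "hnorm ell2 (wcomp w s x) \<le> B * hnorm ell2 x"
proof -
  define S where "S = {n. w n \<noteq> 0}"
  have B0: "0 \<le> B" using B[of 0] norm_ge_zero order_trans by blast
  define f where "f = (\<lambda>n. (cmod (x n))\<^sup>2)"
  have f: "f summable_on A" for A
    using x summable_on_subset_banach[of f UNIV A] by (simp add: ell2_carrier f_def)
  have fs: "(\<lambda>n. B\<^sup>2 * f (s n)) summable_on S"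
    using f[of "s ` S"] inj by (intro summable_on_cmult_right) (simp add: summable_on_reindex S_def o_def)
  have le: "(cmod (wcomp w s x n))\<^sup>2 \<le> B\<^sup>2 * f (s n)" for n
    unfolding f_def power_mult_distrib[symmetric] wcomp_def norm_mult
    using B[of n] by (intro power_mono mult_right_mono) auto
  have sS: "(\<lambda>n. (cmod (wcomp w s x n))\<^sup>2) summable_on S"
    using fs le by (rule summable_on_comparison_test) auto
  then show c: "wcomp w s x \<in> hcarrier ell2"
    unfolding ell2_carrier by (rule summable_on_cong_neutral[THEN iffD1, rotated -1]) (auto simp: S_def wcomp_def)
  have "(hnorm ell2 (wcomp w s x))\<^sup>2 = (\<Sum>\<^sub>\<infinity>n\<in>S. (cmod (wcomp w s x n))\<^sup>2)"
    unfolding ell2_hnorm_sq[OF c] by (rule infsum_cong_neutral) (auto simp: S_def wcomp_def)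
  also have "\<dots> \<le> (\<Sum>\<^sub>\<infinity>n\<in>S. B\<^sup>2 * f (s n))"
    using sS fs le by (rule infsum_mono)
  also have "\<dots> = B\<^sup>2 * infsum f (s ` S)"
    using inj by (simp add: infsum_cmult_right' infsum_reindex S_def o_def)
  also have "\<dots> \<le> B\<^sup>2 * infsum f UNIV"
    by (intro mult_left_mono infsum_mono2 f) (auto simp: f_def)
  also have "\<dots> = (B * hnorm ell2 x)\<^sup>2"
    using ell2_hnorm_sq[OF x] by (simp add: power_mult_distrib f_def)
  finally show "hnorm ell2 (wcomp w s x) \<le> B * hnorm ell2 x"
    by (rule power2_le_imp_le) (use B0 ell2.hnorm_ge_zero[OF x] in simp)
qed

lemma bounded_operator_wcomp:
  assumes "\<And>n. cmod (w n) \<le> B" and "inj_on s {n. w n \<noteq> 0}"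
  shows "bounded_operator ell2 (wcomp w s)"
  unfolding bounded_operator_def
  using wcomp_bound[OF assms] by (auto simp: wcomp_def ell2_scale algebra_simps)

text \<open>The adjoint of a weighted partial injection is the inverse partial injection with conjugated
  weights; values of \<open>s\<close> where \<open>w\<close> vanishes are irrelevant.\<close>

definition inverse_weights ::
    "('i \<Rightarrow> complex) \<Rightarrow> ('i \<Rightarrow> 'i) \<Rightarrow> ('i \<Rightarrow> complex) \<Rightarrow> ('i \<Rightarrow> 'i) \<Rightarrow> bool" where
  "inverse_weights w s w' s' \<longleftrightarrow>
     (\<forall>n. w n \<noteq> 0 \<longrightarrow> s' (s n) = n \<and> w' (s n) = cnj (w n)) \<and>
     (\<forall>n. w' n \<noteq> 0 \<longrightarrow> s (s' n) = n \<and> w (s' n) = cnj (w' n))"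

text \<open>\<open>s\<close> and \<open>s'\<close> are inverse bijections between the supports of
  \<open>w\<close> and \<open>w'\<close>; reindexing the inner product along them moves the weights
  to the other side.\<close>

lemma adjoint_pair_wcomp:
  assumes B: "\<And>n. cmod (w n) \<le> B" and inv: "inverse_weights w s w' s'"
  shows "adjoint_pair ell2 (wcomp w s) (wcomp w' s')"
proof -
  define S where "S = {n. w n \<noteq> 0}"
  define S' where "S' = {n. w' n \<noteq> 0}"
  have B0: "0 \<le> B" using B[of 0] norm_ge_zero order_trans by blast
  have 1: "s n \<in> S'" "s' (s n) = n" "w' (s n) = cnj (w n)" if "n \<in> S" for n
    using inv that by (auto simp: inverse_weights_def S_def S'_def)
  have 2: "s' n \<in> S" "s (s' n) = n" "w (s' n) = cnj (w' n)" if "n \<in> S'" for n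
    using inv that by (auto simp: inverse_weights_def S_def S'_def)
  have B': "cmod (w' n) \<le> B" for n
  proof (cases "n \<in> S'")
    case True
    then show ?thesis using 2(3)[OF True] B[of "s' n"] by simp
  qed (use B0 in \<open>simp add: S'_def\<close>)
  have "bounded_operator ell2 (wcomp w s)"
    by (rule bounded_operator_wcomp[OF B]) (metis 1(2) S_def inj_on_inverseI)
  moreover have "bounded_operator ell2 (wcomp w' s')"
    by (rule bounded_operator_wcomp[OF B']) (metis 2(2) S'_def inj_on_inverseI)
  moreover have "hinner ell2 (wcomp w s x) y = hinner ell2 x (wcomp w' s' y)" for x y
  proof -
    have "hinner ell2 (wcomp w s x) y = (\<Sum>\<^sub>\<infinity>n\<in>S. w n * x (s n) * cnj (y n))"
      unfolding ell2_inner wcomp_def by (rule infsum_cong_neutral) (auto simp: S_def)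
    also have "\<dots> = (\<Sum>\<^sub>\<infinity>n\<in>S'. x n * cnj (w' n * y (s' n)))"
      by (rule infsum_reindex_bij_witness[of S s' s]) (use 1 2 in auto)
    also have "\<dots> = hinner ell2 x (wcomp w' s' y)"
      unfolding ell2_inner wcomp_def by (rule infsum_cong_neutral) (auto simp: S'_def)
    finally show ?thesis .
  qed
  ultimately show ?thesis by (simp add: adjoint_pair_def)
qed

lemma wcomp_unit_seq:
  assumes "inverse_weights w s w' s'"
  shows "wcomp w s (unit_seq m) = hscale ell2 (cnj (w' m)) (unit_seq (s' m))"
proof
  fix n
  show "wcomp w s (unit_seq m) n = hscale ell2 (cnj (w' m)) (unit_seq (s' m)) n"
    using assms unfolding inverse_weights_def wcomp_def ell2_scale unit_seq_def
    by (cases "w' m = 0"; cases "w n = 0"; cases "s n = m"; cases "n = s' m") (force+)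
qed

text \<open>Complete continuity, in terms of bounded sequences that converge weakly to \<open>0\<close>.\<close>

definition vanishing :: "((nat \<Rightarrow> complex) \<Rightarrow> nat \<Rightarrow> complex) \<Rightarrow> bool" where
  "vanishing A \<longleftrightarrow> (\<forall>X B. (\<forall>n. X n \<in> hcarrier ell2 \<and> hnorm ell2 (X n) \<le> B) \<longrightarrow>
     (\<forall>i. (\<lambda>n. X n i) \<longlonglongrightarrow> 0) \<longrightarrow> (\<lambda>n. hnorm ell2 (A (X n))) \<longlonglongrightarrow> 0)"

lemma vanishingD:
  assumes "vanishing A" "\<And>n. X n \<in> hcarrier ell2" "\<And>n. hnorm ell2 (X n) \<le> B"
    "\<And>i. (\<lambda>n. X n i) \<longlonglongrightarrow> 0"
  shows "(\<lambda>n. hnorm ell2 (A (X n))) \<longlonglongrightarrow> 0"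
  using assms unfolding vanishing_def by blast

text \<open>The weights tend to \<open>0\<close>, so they split into finitely many, whose
  contribution is governed by finitely many coordinates, and a tail of operator norm at most
  \<open>e\<close>.\<close>

lemma vanishing_wcomp:
  assumes fin: "\<And>e. e > 0 \<Longrightarrow> finite {n. cmod (w n) \<ge> e}" and inj: "inj_on s {n. w n \<noteq> 0}"
  shows "vanishing (wcomp w s)"
  unfolding vanishing_def
proof (intro allI impI)
  fix X :: "nat \<Rightarrow> nat \<Rightarrow> complex" and B
  assume X: "\<forall>n. X n \<in> hcarrier ell2 \<and> hnorm ell2 (X n) \<le> B" and lim: "\<forall>i. (\<lambda>n. X n i) \<longlonglongrightarrow> 0"
  show "(\<lambda>n. hnorm ell2 (wcomp w s (X n))) \<longlonglongrightarrow> 0"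
  proof (rule LIMSEQ_I)
    fix r :: real assume r: "r > 0"
    have B0: "0 \<le> B" using X ell2.hnorm_ge_zero order_trans by blast
    \<comment> \<open>Adding \<open>1\<close> keeps the division legitimate when
      \<open>B = 0\<close>; the tail then contributes at most \<open>r / 2\<close>.\<close>
    define e where "e = r / 2 / (B + 1)"
    have e: "e > 0" using r B0 by (simp add: e_def)
    define F where "F = {n. cmod (w n) \<ge> e}"
    have F: "finite F" using fin[OF e] by (simp add: F_def)
    define u where "u n = (if n \<in> F then w n else 0)" for n
    define v where "v n = (if n \<in> F then 0 else w n)" for n
    have split: "wcomp w s x = wcomp u s x + wcomp v s x" for x
      by (rule ext) (simp add: wcomp_def u_def v_def)
    have uc: "wcomp u s x \<in> hcarrier ell2"
      and un: "(hnorm ell2 (wcomp u s x))\<^sup>2 = (\<Sum>i\<in>F. (cmod (u i * x (s i)))\<^sup>2)" for x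
      using ell2_finite_support[OF F, of "wcomp u s x"] by (auto simp: wcomp_def u_def)
    have vb: "cmod (v n) \<le> e" for n using e by (auto simp: v_def F_def)
    have vi: "inj_on s {n. v n \<noteq> 0}" using inj by (rule inj_on_subset) (auto simp: v_def)
    have "e * B \<le> r / 2"
    proof -
      have "e * B \<le> e * (B + 1)" using e by simp
      also have "\<dots> = r / 2"
        unfolding e_def using B0 by (intro nonzero_eq_divide_eq[THEN iffD1, OF _ refl]) auto
      finally show ?thesis .
    qed
    moreover have "e * hnorm ell2 (X n) \<le> e * B" for n
      using X e by (intro mult_left_mono) auto
    ultimately have vn: "wcomp v s (X n) \<in> hcarrier ell2" "hnorm ell2 (wcomp v s (X n)) \<le> r / 2" for n
      using wcomp_bound[OF vb vi, of "X n"] X by (blast, meson order_trans)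
    have "(\<lambda>n. \<Sum>i\<in>F. (cmod (u i * X n (s i)))\<^sup>2) \<longlonglongrightarrow> (\<Sum>i\<in>F. (cmod (u i * 0))\<^sup>2)"
      using lim by (intro tendsto_intros) auto
    then have "(\<lambda>n. (hnorm ell2 (wcomp u s (X n)))\<^sup>2) \<longlonglongrightarrow> 0"
      by (simp add: un)
    then have "(\<lambda>n. hnorm ell2 (wcomp u s (X n))) \<longlonglongrightarrow> 0" by simp
    then obtain N where N: "\<And>n. n \<ge> N \<Longrightarrow> \<bar>hnorm ell2 (wcomp u s (X n))\<bar> < r / 2"
      using r LIMSEQ_D[of _ 0 "r / 2"] by (metis diff_0_right half_gt_zero real_norm_def)
    have "norm (hnorm ell2 (wcomp w s (X n)) - 0) < r" if "n \<ge> N" for n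
    proof -
      have "hnorm ell2 (wcomp u s (X n)) < r / 2"
        using N[OF that] by simp
      then have "hnorm ell2 (wcomp w s (X n)) < r"
        using ell2.hnorm_triangle[OF uc[of "X n"] vn(1)[of n]] vn(2)[of n] by (simp add: split)
      moreover have "wcomp w s (X n) \<in> hcarrier ell2"
        unfolding split using uc vn(1) by blast
      ultimately show ?thesis using ell2.hnorm_ge_zero by simp
    qed
    then show "\<exists>N. \<forall>n\<ge>N. norm (hnorm ell2 (wcomp w s (X n)) - 0) < r" by blast
  qed
qed

text \<open>With entrywise domination an operator does not have to be an exact sum of weighted
  injections; estimating its entries is enough.\<close>

lemma vanishing_dominated:
  assumes R: "finite R" and W: "\<And>r. r \<in> R \<Longrightarrow> vanishing (W r)"
    "\<And>r x. \<lbrakk>r \<in> R; x \<in> hcarrier ell2\<rbrakk> \<Longrightarrow> W r x \<in> hcarrier ell2"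
    and A: "\<And>x. x \<in> hcarrier ell2 \<Longrightarrow> A x \<in> hcarrier ell2"
    and le: "\<And>x n. x \<in> hcarrier ell2 \<Longrightarrow> cmod (A x n) \<le> (\<Sum>r\<in>R. cmod (W r x n))"
  shows "vanishing A"
  unfolding vanishing_def
proof (intro allI impI)
  fix X :: "nat \<Rightarrow> nat \<Rightarrow> complex" and B
  assume X: "\<forall>n. X n \<in> hcarrier ell2 \<and> hnorm ell2 (X n) \<le> B" and lim: "\<forall>i. (\<lambda>n. X n i) \<longlonglongrightarrow> 0"
  have "(\<lambda>n. \<Sum>r\<in>R. hnorm ell2 (W r (X n))) \<longlonglongrightarrow> (\<Sum>r\<in>R. 0)"
    by (intro tendsto_sum vanishingD[OF W(1), where B = B]) (use X lim in auto)
  then have "(\<lambda>n. \<Sum>r\<in>R. hnorm ell2 (W r (X n))) \<longlonglongrightarrow> 0" by simp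
  then show "(\<lambda>n. hnorm ell2 (A (X n))) \<longlonglongrightarrow> 0"
  proof (rule tendsto_sandwich[OF _ _ tendsto_const, rotated 2])
    show "\<forall>\<^sub>F n in sequentially. 0 \<le> hnorm ell2 (A (X n))"
      using X A ell2.hnorm_ge_zero by (auto intro!: always_eventually)
    show "\<forall>\<^sub>F n in sequentially. hnorm ell2 (A (X n)) \<le> (\<Sum>r\<in>R. hnorm ell2 (W r (X n)))"
      using X W(2) le by (intro always_eventually allI ell2_dominated R) auto
  qed
qed

lemma vanishing_compose:
  assumes A: "bounded_operator ell2 A" and B: "vanishing B"
    and Bc: "\<And>x. x \<in> hcarrier ell2 \<Longrightarrow> B x \<in> hcarrier ell2"
  shows "vanishing (\<lambda>x. A (B x))"
  unfolding vanishing_def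
proof (intro allI impI)
  fix X :: "nat \<Rightarrow> nat \<Rightarrow> complex" and b
  assume X: "\<forall>n. X n \<in> hcarrier ell2 \<and> hnorm ell2 (X n) \<le> b" and lim: "\<forall>i. (\<lambda>n. X n i) \<longlonglongrightarrow> 0"
  obtain c where c: "\<And>x. x \<in> hcarrier ell2 \<Longrightarrow> hnorm ell2 (A x) \<le> c * hnorm ell2 x"
    using ell2.bounded_operator_bound[OF A] by blast
  have "(\<lambda>n. c * hnorm ell2 (B (X n))) \<longlonglongrightarrow> c * 0"
    by (intro tendsto_mult_left vanishingD[OF B, where B = b]) (use X lim in auto)
  then have "(\<lambda>n. c * hnorm ell2 (B (X n))) \<longlonglongrightarrow> 0" by simp
  then show "(\<lambda>n. hnorm ell2 (A (B (X n)))) \<longlonglongrightarrow> 0"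
  proof (rule tendsto_sandwich[OF _ _ tendsto_const, rotated 2])
    show "\<forall>\<^sub>F n in sequentially. 0 \<le> hnorm ell2 (A (B (X n)))"
      using X Bc bounded_operatorD(1)[OF A] ell2.hnorm_ge_zero by (auto intro!: always_eventually)
    show "\<forall>\<^sub>F n in sequentially. hnorm ell2 (A (B (X n))) \<le> c * hnorm ell2 (B (X n))"
      using X Bc c by (auto intro!: always_eventually)
  qed
qed

lemma vanishing_diff:
  assumes A: "vanishing A" "\<And>x. x \<in> hcarrier ell2 \<Longrightarrow> A x \<in> hcarrier ell2"
    and B: "vanishing B" "\<And>x. x \<in> hcarrier ell2 \<Longrightarrow> B x \<in> hcarrier ell2"
  shows "vanishing (\<lambda>x. A x - B x)"
proof (rule vanishing_dominated[of "UNIV :: bool set" "\<lambda>b. if b then A else B"])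
  show "cmod ((A x - B x) n) \<le> (\<Sum>r\<in>UNIV. cmod ((if r then A else B) x n))" for x n
    by (simp add: UNIV_bool norm_triangle_ineq4 add.commute)
qed (use A B in auto)

text \<open>A countable product of closed discs is compact by Tychonoff and metrizable, hence
  sequentially compact; this replaces a diagonal argument.\<close>

lemma bounded_sequence_coordinatewise_subseq:
  fixes X :: "nat \<Rightarrow> nat \<Rightarrow> complex"
  assumes "\<And>n i. cmod (X n i) \<le> B"
  shows "\<exists>r y. strict_mono r \<and> (\<forall>i. (\<lambda>n. X (r n) i) \<longlonglongrightarrow> y i)"
proof -
  have "compact (PiE UNIV (\<lambda>i::nat. cball (0::complex) B))"
    using compactin_PiE[of "\<lambda>i. euclidean" UNIV "\<lambda>i::nat. cball (0::complex) B"]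
    by (simp add: euclidean_product_topology)
  then have "seq_compact (PiE UNIV (\<lambda>i::nat. cball (0::complex) B))"
    by (simp add: compact_eq_seq_compact_metric)
  moreover have "\<forall>n. X n \<in> PiE UNIV (\<lambda>i::nat. cball (0::complex) B)"
    using assms by (auto simp: dist_norm)
  ultimately obtain y r where "strict_mono r" and lim: "(X \<circ> r) \<longlonglongrightarrow> y"
    unfolding seq_compact_def by metis
  moreover have "(\<lambda>n. X (r n) i) \<longlonglongrightarrow> y i" for i
    using continuous_on_tendsto_compose[OF continuous_on_product_coordinates lim, of i]
    by (simp add: o_def)
  ultimately show ?thesis by blast
qed

text \<open>A sequence in the unit ball has a subsequence converging coordinatewise to some
  \<open>y\<close> in the ball. Subtracting \<open>y\<close> makes it weakly null, so the images
  converge in norm; total boundedness and completeness then give a compact closure.\<close>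

lemma compact_operatorI:
  assumes A: "bounded_operator ell2 A" and v: "vanishing A"
  shows "compact_operator ell2 A"
proof -
  define S where "S = A ` {x \<in> hcarrier ell2. hnorm ell2 x \<le> 1}"
  have Sc: "S \<subseteq> hcarrier ell2" using bounded_operatorD(1)[OF A] by (auto simp: S_def)
  have "\<exists>r. strict_mono r \<and> ell2.MCauchy (\<sigma> \<circ> r)" if "range \<sigma> \<subseteq> S" for \<sigma> :: "nat \<Rightarrow> _"
  proof -
    have "\<forall>n. \<exists>x. x \<in> hcarrier ell2 \<and> hnorm ell2 x \<le> 1 \<and> \<sigma> n = A x"
      using that unfolding S_def by blast
    then obtain X where X: "\<And>n. X n \<in> hcarrier ell2" "\<And>n. hnorm ell2 (X n) \<le> 1" "\<And>n. \<sigma> n = A (X n)"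
      by metis
    have "cmod (X n i) \<le> 1" for n i
      using ell2_coordinate_le[OF X(1)] X(2) order_trans by blast
    then obtain r y where r: "strict_mono r" and y: "\<And>i. (\<lambda>n. X (r n) i) \<longlonglongrightarrow> y i"
      using bounded_sequence_coordinatewise_subseq[of X 1] by blast
    have yc: "y \<in> hcarrier ell2" "hnorm ell2 y \<le> 1"
      using ell2_coordinatewise_limit[of "\<lambda>n. X (r n)" 1 y] X y by auto
    have "(\<lambda>n. hnorm ell2 (A (X (r n) - y))) \<longlonglongrightarrow> 0"
    proof (rule vanishingD[OF v])
      show "X (r n) - y \<in> hcarrier ell2" for n using X yc by blast
      show "hnorm ell2 (X (r n) - y) \<le> 2" for n
        using ell2.hnorm_diff_le[OF X(1) yc(1), of "r n"] X(2)[of "r n"] yc(2) by linarith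
      show "(\<lambda>n. (X (r n) - y) i) \<longlonglongrightarrow> 0" for i
        using tendsto_diff[OF y[of i] tendsto_const[of "y i"]] by simp
    qed
    moreover have "A (X (r n) - y) = A (X (r n)) - A y" for n
      using bounded_operatorD(2)[OF A, of "X (r n) - y" y] X yc by (simp add: algebra_simps)
    ultimately have lim: "(\<lambda>n. hnorm ell2 (A (X (r n)) - A y)) \<longlonglongrightarrow> 0" by simp
    have Ac: "A (X n) \<in> hcarrier ell2" "A y \<in> hcarrier ell2" for n
      using bounded_operatorD(1)[OF A] X yc by auto
    have "limitin ell2.mtopology (\<sigma> \<circ> r) (A y) sequentially"
      unfolding ell2.limit_metric_sequentially
    proof (intro conjI allI impI)
      fix e :: real assume "e > 0"
      then obtain N where N: "\<And>n. n \<ge> N \<Longrightarrow> hnorm ell2 (A (X (r n)) - A y) < e"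
        using LIMSEQ_D[OF lim] by fastforce
      then show "\<exists>N. \<forall>n\<ge>N. (\<sigma> \<circ> r) n \<in> hcarrier ell2 \<and> hdist ell2 ((\<sigma> \<circ> r) n) (A y) < e"
        using Ac X(3) by (intro exI[of _ N]) (auto simp: hdist_def)
    qed (use Ac in auto)
    then have "ell2.MCauchy (\<sigma> \<circ> r)"
      using Ac X(3) by (intro ell2.convergent_imp_MCauchy) auto
    then show ?thesis using r by blast
  qed
  then have "ell2.mtotally_bounded S"
    using Sc by (auto simp: ell2.mtotally_bounded_sequentially)
  then show ?thesis
    using A ell2.mtotally_bounded_eq_compact_closure_of[OF ell2_complete, of S]
    by (simp add: compact_operator_def htopology_def S_def)
qed

lemma ell2_orthonormal_basisI:
  assumes "\<And>n. e n \<in> hcarrier ell2"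
    and "\<And>m n. hinner ell2 (e m) (e n) = (if m = n then 1 else 0)"
    and "\<And>m. unit_seq m \<in> ell2.span (range e)"
  shows "orthonormal_basis ell2 e"
  unfolding orthonormal_basis_def using assms ell2_dense_span[of "range e"] by auto

lemma orthonormal_basis_unit_seq: "orthonormal_basis ell2 unit_seq"
  by (rule ell2_orthonormal_basisI) (auto simp: ell2_inner_unit_seq unit_seq_apply ell2.span_base)

section \<open>Forward and backward lines\<close>

text \<open>Each line is cut into windows: window \<open>j = a + b\<close> has \<open>j + 1\<close> points, and \<open>Fwd k a b\<close> is its
  point number \<open>a\<close> on the \<open>k\<close>-th forward line. A backward line runs through its windows in
  decreasing order of \<open>j\<close>, but through each window in increasing order of \<open>a\<close>, parallel to the forward line.\<close>

datatype idx = Fwd nat nat nat | Bwd nat nat nat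

instance idx :: countable
  by countable_datatype

text \<open>Only finitely many indices have a size below a given bound, so decay in
  \<open>idx_size\<close> is decay along any enumeration of the indices.\<close>

fun idx_size :: "idx \<Rightarrow> nat" where
  "idx_size (Fwd k a b) = k + a + b"
| "idx_size (Bwd k a b) = k + a + b"

lemma finite_idx_size_le: "finite {i. idx_size i \<le> m}"
proof (rule finite_subset)
  show "{i. idx_size i \<le> m} \<subseteq> (\<lambda>(k, a, b). Fwd k a b) ` ({..m} \<times> {..m} \<times> {..m})
      \<union> (\<lambda>(k, a, b). Bwd k a b) ` ({..m} \<times> {..m} \<times> {..m})"
  proof
    fix i assume "i \<in> {i. idx_size i \<le> m}"
    then show "i \<in> (\<lambda>(k, a, b). Fwd k a b) ` ({..m} \<times> {..m} \<times> {..m})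
      \<union> (\<lambda>(k, a, b). Bwd k a b) ` ({..m} \<times> {..m} \<times> {..m})"
      by (cases i) (auto simp: image_iff)
  qed
qed auto

section \<open>Transport from the index type to the natural numbers\<close>

definition enc :: "idx \<Rightarrow> nat" where
  "enc = to_nat_on UNIV"

definition dec :: "nat \<Rightarrow> idx" where
  "dec = from_nat_into UNIV"

lemma infinite_idx: "infinite (UNIV :: idx set)"
proof
  assume "finite (UNIV :: idx set)"
  then have "finite (range (\<lambda>k. Fwd k 0 0))" by (rule finite_subset[rotated]) auto
  then show False by (simp add: finite_image_iff inj_def)
qed

lemma dec_enc [simp]: "dec (enc i) = i"
  by (simp add: enc_def dec_def)

lemma enc_dec [simp]: "enc (dec n) = n"
  by (simp add: enc_def dec_def infinite_idx)

lemma enc_eq_iff [simp]: "enc i = enc j \<longleftrightarrow> i = j"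
  by (metis dec_enc)

lemma seq_eqI: "(\<And>i. x (enc i) = y (enc i)) \<Longrightarrow> x = y"
  by (metis enc_dec ext)

definition pullback :: "(idx \<Rightarrow> complex) \<Rightarrow> (idx \<Rightarrow> idx) \<Rightarrow> (nat \<Rightarrow> complex) \<Rightarrow> nat \<Rightarrow> complex" where
  "pullback w s = wcomp (\<lambda>n. w (dec n)) (\<lambda>n. enc (s (dec n)))"

lemma pullback_apply [simp]: "pullback w s x (enc i) = w i * x (enc (s i))"
  by (simp add: pullback_def wcomp_def)

lemma inverse_weights_dec:
  "inverse_weights w s w' s' \<Longrightarrow> inverse_weights (\<lambda>n. w (dec n)) (\<lambda>n. enc (s (dec n)))
     (\<lambda>n. w' (dec n)) (\<lambda>n. enc (s' (dec n)))"
  by (simp add: inverse_weights_def)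

lemma adjoint_pair_pullback:
  assumes "\<And>i. cmod (w i) \<le> B" and "inverse_weights w s w' s'"
  shows "adjoint_pair ell2 (pullback w s) (pullback w' s')"
  unfolding pullback_def using assms by (intro adjoint_pair_wcomp inverse_weights_dec)

lemma bounded_operator_pullback:
  assumes "\<And>i. cmod (w i) \<le> B" and "inj_on s {i. w i \<noteq> 0}"
  shows "bounded_operator ell2 (pullback w s)"
  unfolding pullback_def
proof (rule bounded_operator_wcomp)
  show "inj_on (\<lambda>n. enc (s (dec n))) {n. w (dec n) \<noteq> 0}"
    using assms(2) by (auto simp: inj_on_def) (metis enc_dec)
qed (rule assms)

lemma pullback_unit_seq:
  assumes "inverse_weights w s w' s'"
  shows "pullback w s (unit_seq (enc i)) = hscale ell2 (cnj (w' i)) (unit_seq (enc (s' i)))"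
  unfolding pullback_def using wcomp_unit_seq[OF inverse_weights_dec[OF assms], of "enc i"] by simp

text \<open>The square root is dictated by the couplings at the line starts, which must not be
  square-summable; the other weights decay faster.\<close>

lemma vanishing_pullback:
  assumes w: "\<And>i. cmod (w i) \<le> C / sqrt (real (idx_size i) + 1)" and inj: "inj_on s {i. w i \<noteq> 0}"
  shows "vanishing (pullback w s)"
  unfolding pullback_def
proof (rule vanishing_wcomp)
  fix e :: real assume e: "e > 0"
  obtain m :: nat where m: "(C / e)\<^sup>2 \<le> real m" using real_arch_simple by blast
  have "{n. e \<le> cmod (w (dec n))} \<subseteq> enc ` {i. idx_size i \<le> m}"
  proof
    fix n assume "n \<in> {n. e \<le> cmod (w (dec n))}"
    define t where "t = sqrt (real (idx_size (dec n)) + 1)"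
    have t: "t > 0" by (simp add: t_def add_nonneg_pos)
    have "e \<le> C / t" using \<open>n \<in> _\<close> w[of "dec n"] by (simp add: t_def)
    then have "t \<le> C / e" using e t by (simp add: field_simps)
    then have "t\<^sup>2 \<le> (C / e)\<^sup>2" using t by (intro power_mono) auto
    then have "real (idx_size (dec n)) + 1 \<le> real m" using m by (simp add: t_def)
    then have "idx_size (dec n) \<le> m" by linarith
    then show "n \<in> enc ` {i. idx_size i \<le> m}" by (metis enc_dec imageI mem_Collect_eq)
  qed
  then show "finite {n. e \<le> cmod (w (dec n))}"
    by (rule finite_subset) (simp add: finite_idx_size_le)
next
  show "inj_on (\<lambda>n. enc (s (dec n))) {n. w (dec n) \<noteq> 0}"
    using inj by (auto simp: inj_on_def) (metis enc_dec)
qed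

section \<open>Slowly varying weights and rotation angles\<close>

definition radius :: "nat \<Rightarrow> nat \<Rightarrow> real" where
  "radius k j = real j / (real j + real k + 1)"

lemma radius_nonneg: "0 \<le> radius k j" and radius_le_1: "radius k j \<le> 1"
  by (auto simp: radius_def)

text \<open>\<open>radius\<close> is made to vary slowly in both arguments: passing to a
  neighbouring window or line costs an amount that tends to \<open>0\<close> with
  \<open>j + k\<close>, while the weights still tend to \<open>1\<close> along each line. The
  numerator \<open>n\<close> is arranged so that it is visibly at most \<open>s'\<close>.\<close>

lemma radius_diff:
  assumes "\<bar>real j - real j'\<bar> \<le> 1" "\<bar>real k - real k'\<bar> \<le> 1"
  shows "\<bar>radius k j - radius k' j'\<bar> \<le> 1 / (real j + real k + 1)"
proof -
  define s s' where "s = real j + real k + 1" and "s' = real j' + real k' + 1"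
  have s: "s > 0" "s' > 0" by (simp_all add: s_def s'_def add_nonneg_pos)
  define n where "n = real j' * (real k' - real k) + (real k' + 1) * (real j - real j')"
  have "radius k j - radius k' j' = (real j * s' - real j' * s) / (s * s')"
    using s unfolding radius_def s_def[symmetric] s'_def[symmetric] by (simp add: diff_frac_eq)
  also have "real j * s' - real j' * s = n"
    by (simp add: n_def s_def s'_def algebra_simps)
  finally have "\<bar>radius k j - radius k' j'\<bar> = \<bar>n\<bar> / (s * s')"
    using s by (simp add: abs_mult)
  moreover have "\<bar>n\<bar> \<le> s'"
  proof -
    have "\<bar>n\<bar> \<le> real j' * \<bar>real k' - real k\<bar> + (real k' + 1) * \<bar>real j - real j'\<bar>"
      unfolding n_def by (rule order_trans[OF abs_triangle_ineq]) (simp add: abs_mult)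
    also have "\<dots> \<le> real j' * 1 + (real k' + 1) * 1"
      using assms by (intro add_mono mult_left_mono) auto
    finally show ?thesis by (simp add: s'_def)
  qed
  ultimately have "\<bar>radius k j - radius k' j'\<bar> \<le> s' / (s * s')"
    using s by (simp only: divide_right_mono mult_pos_pos less_imp_le)
  also have "s' / (s * s') = 1 / s" using s by simp
  finally show ?thesis by (simp only: s_def)
qed

text \<open>Runs from \<open>0\<close> at the first point of window \<open>a + b\<close> to one step
  short of a right angle at its last point, in equal steps of \<open>pi / 2\<close> divided by
  \<open>a + b + 1\<close>.\<close>

definition angle :: "nat \<Rightarrow> nat \<Rightarrow> real" where
  "angle a b = pi / 2 * (real a / (real a + real b + 1))"

lemma angle_0 [simp]: "angle 0 b = 0"
  by (simp add: angle_def)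

lemma half_pi_fraction_le: "c > 0 \<Longrightarrow> c * \<bar>pi / 2 / c\<bar> \<le> 2"
  using pi_less_4 by (simp add: abs_mult)

lemma angle_step: "(real a + real b + 2) * \<bar>angle (Suc a) b - angle a (Suc b)\<bar> \<le> 2"
proof -
  have "angle (Suc a) b - angle a (Suc b) = pi / 2 / (real a + real b + 2)"
    by (simp add: angle_def divide_simps) (simp add: algebra_simps)
  then show ?thesis using half_pi_fraction_le[of "real a + real b + 2"] by (simp only:)
qed

lemma angle_end: "(real b + 1) * \<bar>angle b 0 - pi / 2\<bar> \<le> 2"
proof -
  have "angle b 0 - pi / 2 = - (pi / 2 / (real b + 1))"
    by (simp add: angle_def divide_simps) (simp add: algebra_simps)
  then show ?thesis using half_pi_fraction_le[of "real b + 1"] by (simp only: abs_minus_cancel)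
qed

lemma abs_cos_diff_le: "\<bar>cos x - cos y\<bar> \<le> \<bar>x - y\<bar>" for x y :: real
proof -
  have "\<bar>cos x - cos y\<bar> = 2 * (\<bar>sin ((x + y) / 2)\<bar> * \<bar>sin ((y - x) / 2)\<bar>)"
    unfolding cos_diff_cos by (simp add: abs_mult)
  also have "\<dots> \<le> 2 * (1 * \<bar>(y - x) / 2\<bar>)"
    by (intro mult_left_mono mult_mono abs_sin_le_one abs_sin_x_le_abs_x) auto
  finally show ?thesis by simp
qed

lemma abs_sin_diff_le: "\<bar>sin x - sin y\<bar> \<le> \<bar>x - y\<bar>" for x y :: real
proof -
  have "\<bar>sin x - sin y\<bar> = 2 * (\<bar>sin ((x - y) / 2)\<bar> * \<bar>cos ((x + y) / 2)\<bar>)"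
    unfolding sin_diff_sin by (simp add: abs_mult)
  also have "\<dots> \<le> 2 * (\<bar>(x - y) / 2\<bar> * 1)"
    by (intro mult_left_mono mult_mono abs_cos_le_one abs_sin_x_le_abs_x) auto
  finally show ?thesis by simp
qed

text \<open>A product rule for two slowly varying factors. The numerator \<open>j\<close> of
  \<open>radius\<close> absorbs the step of the trigonometric factor, and the factor
  \<open>2\<close> in the bound on \<open>N\<close> leaves room for shifts between neighbouring
  lines.\<close>

lemma radius_mult_diff:
  assumes "\<bar>real j - real j'\<bar> \<le> 1" "\<bar>real k - real k'\<bar> \<le> 1"
    and t: "real j * \<bar>t - t'\<bar> \<le> 2" "\<bar>t'\<bar> \<le> 1" and N: "real N + 1 \<le> 2 * (real j + real k + 1)"
  shows "\<bar>radius k j * t - radius k' j' * t'\<bar> \<le> 8 / (real N + 1)"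
proof -
  have "radius k j * t - radius k' j' * t' = radius k j * (t - t') + (radius k j - radius k' j') * t'"
    by (simp add: algebra_simps)
  then have "\<bar>radius k j * t - radius k' j' * t'\<bar>
      \<le> radius k j * \<bar>t - t'\<bar> + \<bar>radius k j - radius k' j'\<bar> * \<bar>t'\<bar>"
    using abs_triangle_ineq[of "radius k j * (t - t')" "(radius k j - radius k' j') * t'"]
      radius_nonneg[of k j]
    by (simp add: abs_mult)
  also have "\<dots> \<le> 2 / (real j + real k + 1) + 1 / (real j + real k + 1) * 1"
  proof (intro add_mono mult_mono)
    show "radius k j * \<bar>t - t'\<bar> \<le> 2 / (real j + real k + 1)"
      using divide_right_mono[OF t(1), of "real j + real k + 1"] by (simp add: radius_def)
  qed (use radius_diff[OF assms(1,2)] t in auto)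
  also have "\<dots> \<le> 8 / (real N + 1)"
  proof -
    have "2 / (real j + real k + 1) + 1 / (real j + real k + 1) * 1 = 3 / (real j + real k + 1)"
      by (simp add: add_divide_distrib[symmetric])
    also have "\<dots> \<le> 8 / (real N + 1)"
      using N by (subst frac_le_eq) (auto simp: divide_le_0_iff algebra_simps mult_nonneg_nonneg)
    finally show ?thesis .
  qed
  finally show ?thesis .
qed

section \<open>Rejoining lines and cycles\<close>

text \<open>The operators below act on functions by pulling back, so they are given by predecessor maps:
  the basis vector at \<open>line_pred i\<close> is mapped to a multiple of the one at \<open>i\<close>.\<close>

fun line_weight :: "idx \<Rightarrow> complex" where
  "line_weight (Fwd k (Suc a) b) = complex_of_real (radius k (Suc (a + b)))"
| "line_weight (Fwd k 0 (Suc b)) = complex_of_real (radius k (Suc b))"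
| "line_weight (Fwd k 0 0) = 0"
| "line_weight (Bwd k (Suc a) b) = complex_of_real (radius k (Suc (a + b)))"
| "line_weight (Bwd k 0 b) = complex_of_real (radius k b)"

fun line_pred :: "idx \<Rightarrow> idx" where
  "line_pred (Fwd k (Suc a) b) = Fwd k a (Suc b)"
| "line_pred (Fwd k 0 (Suc b)) = Fwd k b 0"
| "line_pred (Fwd k 0 0) = Fwd k 0 0"
| "line_pred (Bwd k (Suc a) b) = Bwd k a (Suc b)"
| "line_pred (Bwd k 0 b) = Bwd k (Suc b) 0"

text \<open>These points have no predecessor on their line: \<open>line_pred\<close> has the dummy
  value \<open>Fwd k 0 0\<close> there, which is also its value at \<open>Fwd k 0 1\<close>, so it
  is injective only away from them.\<close>

definition line_start :: "idx \<Rightarrow> bool" where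
  "line_start i \<longleftrightarrow> (\<exists>k. i = Fwd k 0 0)"

lemma line_start_simps [simp]:
  "line_start (Fwd k a b) \<longleftrightarrow> a = 0 \<and> b = 0" "\<not> line_start (Bwd k a b)"
  by (auto simp: line_start_def)

lemma inj_on_line_pred: "inj_on line_pred {i. \<not> line_start i}"
proof (rule inj_onI; clarify)
  fix i j assume "line_pred i = line_pred j" "\<not> line_start i" "\<not> line_start j"
  then show "i = j"
    by (cases i rule: line_pred.cases; cases j rule: line_pred.cases) auto
qed

text \<open>The sum of all \<open>W\<^sub>k\<close> and \<open>B\<^sub>k\<close>. It does not depend
  on \<open>d\<close>: both \<open>T\<close> and \<open>D\<close> are compared with this one
  operator.\<close>

definition line_shift :: "(nat \<Rightarrow> complex) \<Rightarrow> nat \<Rightarrow> complex" where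
  "line_shift = pullback line_weight line_pred"

lemma bounded_operator_line_shift: "bounded_operator ell2 line_shift"
  unfolding line_shift_def
proof (rule bounded_operator_pullback[where B = 1])
  show "cmod (line_weight i) \<le> 1" for i
    by (cases i rule: line_weight.cases) (auto simp: radius_nonneg radius_le_1)
  show "inj_on line_pred {i. line_weight i \<noteq> 0}"
    by (rule inj_on_subset[OF inj_on_line_pred]) (auto simp: line_start_def)
qed

lemma norm_comb_le:
  assumes "\<bar>A\<bar> \<le> K" "\<bar>B\<bar> \<le> K"
  shows "cmod (complex_of_real A * X + complex_of_real B * Y) \<le> K * cmod X + K * cmod Y"
proof -
  have "cmod (complex_of_real A * X + complex_of_real B * Y) \<le> \<bar>A\<bar> * cmod X + \<bar>B\<bar> * cmod Y"
    by (rule order_trans[OF norm_triangle_ineq]) (simp add: norm_mult)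
  also have "\<dots> \<le> K * cmod X + K * cmod Y"
    using assms by (intro add_mono mult_right_mono) auto
  finally show ?thesis .
qed

text \<open>The forward line \<open>k + d\<close> is matched with the backward line \<open>k\<close>, so \<open>d = 0\<close> gives \<open>D\<close>, while
  \<open>d = 1\<close> leaves the forward line \<open>0\<close> as an unweighted shift and gives \<open>T\<close>. The starting points of the matched
  forward lines would be isolated; \<open>z\<close> and \<open>q\<close> prescribe the operator there.\<close>

locale weighted_cycles =
  fixes d :: nat and z :: "nat \<Rightarrow> complex" and q :: "nat \<Rightarrow> nat"
  assumes d: "d \<le> 1"
    and qq [simp]: "q (q k) = k"
    and qd: "d \<le> k \<Longrightarrow> d \<le> q k"
    and zd: "k < d \<Longrightarrow> z k = 0"
    and z_le: "cmod (z k) \<le> 2 / sqrt (real k + 1)"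
begin

text \<open>For \<open>j \<ge> 1\<close>, window \<open>j\<close> of forward line
  \<open>k + d\<close> and window \<open>j - 1\<close> of backward line \<open>k\<close> form one
  cycle of \<open>2 j + 1\<close> points. The negative sign on the closing edge cancels the sign of
  \<open>- sin\<close> with which \<open>reflect\<close> nearly exchanges the strands at the end of
  a window.\<close>

fun cycle_weight :: "idx \<Rightarrow> complex" where
  "cycle_weight (Fwd k (Suc a) b) = (if k < d then 1 else complex_of_real (radius (k - d) (Suc (a + b))))"
| "cycle_weight (Fwd k 0 (Suc b)) = (if k < d then 1 else - complex_of_real (radius (k - d) (Suc b)))"
| "cycle_weight (Fwd k 0 0) = z k"
| "cycle_weight (Bwd k (Suc a) b) = complex_of_real (radius k (Suc (Suc (a + b))))"
| "cycle_weight (Bwd k 0 b) = complex_of_real (radius k (Suc b))"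

fun cycle_pred :: "idx \<Rightarrow> idx" where
  "cycle_pred (Fwd k (Suc a) b) = Fwd k a (Suc b)"
| "cycle_pred (Fwd k 0 (Suc b)) = (if k < d then Fwd k b 0 else Bwd (k - d) b 0)"
| "cycle_pred (Fwd k 0 0) = Fwd (q k) 0 0"
| "cycle_pred (Bwd k (Suc a) b) = Bwd k a (Suc b)"
| "cycle_pred (Bwd k 0 b) = Fwd (k + d) (Suc b) 0"

fun cycle_weight' :: "idx \<Rightarrow> complex" where
  "cycle_weight' (Fwd k a (Suc b)) = (if k < d then 1 else complex_of_real (radius (k - d) (Suc (a + b))))"
| "cycle_weight' (Fwd k (Suc a) 0) = (if k < d then 1 else complex_of_real (radius (k - d) (Suc a)))"
| "cycle_weight' (Fwd k 0 0) = (if k < d then 1 else cnj (z (q k)))"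
| "cycle_weight' (Bwd k a (Suc b)) = complex_of_real (radius k (Suc (Suc (a + b))))"
| "cycle_weight' (Bwd k a 0) = - complex_of_real (radius k (Suc a))"

fun cycle_succ :: "idx \<Rightarrow> idx" where
  "cycle_succ (Fwd k a (Suc b)) = Fwd k (Suc a) b"
| "cycle_succ (Fwd k (Suc a) 0) = (if k < d then Fwd k 0 (Suc (Suc a)) else Bwd (k - d) 0 a)"
| "cycle_succ (Fwd k 0 0) = (if k < d then Fwd k 0 (Suc 0) else Fwd (q k) 0 0)"
| "cycle_succ (Bwd k a (Suc b)) = Bwd k (Suc a) b"
| "cycle_succ (Bwd k a 0) = Fwd (k + d) 0 (Suc a)"

lemma cycle_inverse: "inverse_weights cycle_weight cycle_pred cycle_weight' cycle_succ"
proof -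
  have "cycle_succ (cycle_pred i) = i \<and> cycle_weight' (cycle_pred i) = cnj (cycle_weight i)"
    if "cycle_weight i \<noteq> 0" for i
    using that
  proof (cases i rule: cycle_weight.cases)
    case (2 k b)
    then show ?thesis by (cases b) auto
  next
    case (3 k)
    \<comment> \<open>Line starts below \<open>d\<close> are excluded by \<open>zd\<close>, and
      \<open>qd\<close> keeps \<open>q k\<close> in the range where \<open>cycle_succ\<close> undoes
      \<open>cycle_pred\<close>.\<close>
    then have "d \<le> k" using that zd not_less by auto
    then show ?thesis using qd[of k] 3 by auto
  qed auto
  moreover have "cycle_pred (cycle_succ i) = i \<and> cycle_weight (cycle_succ i) = cnj (cycle_weight' i)"
    if "cycle_weight' i \<noteq> 0" for i
    using that by (cases i rule: cycle_weight'.cases) auto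
  ultimately show ?thesis unfolding inverse_weights_def by blast
qed

lemma z_le_2: "cmod (z k) \<le> 2"
proof -
  have "2 / sqrt (real k + 1) \<le> 2 / 1" by (intro divide_left_mono) auto
  then show ?thesis using z_le[of k] by simp
qed

lemma cycle_weight_le: "cmod (cycle_weight i) \<le> 2"
proof -
  have "\<bar>radius k j\<bar> \<le> 2" for k j using radius_nonneg[of k j] radius_le_1[of k j] by simp
  then show ?thesis by (cases i rule: cycle_weight.cases) (auto simp: z_le_2)
qed

definition cycles :: "(nat \<Rightarrow> complex) \<Rightarrow> nat \<Rightarrow> complex" where
  "cycles = pullback cycle_weight cycle_pred"

definition cycles' :: "(nat \<Rightarrow> complex) \<Rightarrow> nat \<Rightarrow> complex" where
  "cycles' = pullback cycle_weight' cycle_succ"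

lemma adjoint_pair_cycles: "adjoint_pair ell2 cycles cycles'"
  unfolding cycles_def cycles'_def by (rule adjoint_pair_pullback[OF cycle_weight_le cycle_inverse])

section \<open>Reflections in the planes of parallel strands\<close>

fun partner :: "idx \<Rightarrow> idx" where
  "partner (Fwd k a b) = (if k < d then Fwd k a b else Bwd (k - d) a b)"
| "partner (Bwd k a b) = Fwd (k + d) a b"

lemma partner_partner [simp]: "partner (partner i) = i"
  by (cases i) auto

fun refl_diag :: "idx \<Rightarrow> real" where
  "refl_diag (Fwd k a b) = (if k < d then 1 else cos (angle a b))"
| "refl_diag (Bwd k a b) = - cos (angle a b)"

fun refl_off :: "idx \<Rightarrow> real" where
  "refl_off (Fwd k a b) = (if k < d then 0 else - sin (angle a b))"
| "refl_off (Bwd k a b) = - sin (angle a b)"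

text \<open>On the plane of a point and its partner this is a reflection rather than a rotation, so
  that the operator is self-adjoint and its own inverse. It is diagonal at the start of a window and
  nearly exchanges the two strands at its end.\<close>

definition reflect :: "(nat \<Rightarrow> complex) \<Rightarrow> nat \<Rightarrow> complex" where
  "reflect x = pullback (\<lambda>i. complex_of_real (refl_diag i)) (\<lambda>i. i) x
     + pullback (\<lambda>i. complex_of_real (refl_off i)) partner x"

lemma reflect_apply: "reflect x (enc i) =
    complex_of_real (refl_diag i) * x (enc i) + complex_of_real (refl_off i) * x (enc (partner i))"
  by (simp add: reflect_def)

lemma reflect_simps:
  "k < d \<Longrightarrow> reflect x (enc (Fwd k a b)) = x (enc (Fwd k a b))"
  "d \<le> k \<Longrightarrow> reflect x (enc (Fwd k a b)) =
     complex_of_real (cos (angle a b)) * x (enc (Fwd k a b))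
     - complex_of_real (sin (angle a b)) * x (enc (Bwd (k - d) a b))"
  "reflect x (enc (Bwd k a b)) =
     - complex_of_real (sin (angle a b)) * x (enc (Fwd (k + d) a b))
     - complex_of_real (cos (angle a b)) * x (enc (Bwd k a b))"
  by (simp_all add: reflect_apply)

lemma reflect_add: "reflect (x + y) = reflect x + reflect y"
  and reflect_diff: "reflect (x - y) = reflect x - reflect y"
  and reflect_scale: "reflect (hscale ell2 c x) = hscale ell2 c (reflect x)"
  by (rule seq_eqI; simp add: reflect_apply ell2_scale algebra_simps)+

lemma reflect_reflect [simp]: "reflect (reflect x) = x"
proof (rule seq_eqI)
  fix i
  have *: "refl_diag i * refl_diag i + refl_off i * refl_off (partner i) = 1"
    "refl_diag i * refl_off i + refl_off i * refl_diag (partner i) = 0"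
    by (cases i; simp add: power2_eq_square[symmetric])+
  have "reflect (reflect x) (enc i) =
      complex_of_real (refl_diag i * refl_diag i + refl_off i * refl_off (partner i)) * x (enc i)
      + complex_of_real (refl_diag i * refl_off i + refl_off i * refl_diag (partner i)) * x (enc (partner i))"
    by (simp add: reflect_apply algebra_simps)
  then show "reflect (reflect x) (enc i) = x (enc i)" by (simp only: *) simp
qed

lemma adjoint_pair_reflect: "adjoint_pair ell2 reflect reflect"
proof -
  have "cmod (complex_of_real (refl_diag i)) \<le> 1" "cmod (complex_of_real (refl_off i)) \<le> 1" for i
    by (cases i; simp)+
  moreover have "refl_off (partner i) = refl_off i" for i
    by (cases i) auto
  ultimately show ?thesis
    unfolding reflect_def
    by (intro ell2.adjoint_pair_add adjoint_pair_pullback[where B = 1]) (auto simp: inverse_weights_def)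
qed

lemmas bounded_cycles = adjoint_pairD(1)[OF adjoint_pair_cycles]
  and bounded_reflect = adjoint_pairD(1)[OF adjoint_pair_reflect]

definition op :: "(nat \<Rightarrow> complex) \<Rightarrow> nat \<Rightarrow> complex" where
  "op x = reflect (cycles (reflect x))"

definition op' :: "(nat \<Rightarrow> complex) \<Rightarrow> nat \<Rightarrow> complex" where
  "op' x = reflect (cycles' (reflect x))"

lemma adjoint_pair_op: "adjoint_pair ell2 op op'"
  unfolding op_def op'_def
  by (rule ell2.adjoint_pair_compose[OF ell2.adjoint_pair_compose[OF adjoint_pair_reflect adjoint_pair_cycles] adjoint_pair_reflect,
        THEN ell2.adjoint_pair_cong]) auto

text \<open>As \<open>reflect\<close> is an involution,
  \<open>reflect (defect x) = op x - line_shift x\<close>. In the present form each entry away from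
  line starts involves only two values of \<open>x\<close>.\<close>

definition defect :: "(nat \<Rightarrow> complex) \<Rightarrow> nat \<Rightarrow> complex" where
  "defect x = cycles (reflect x) - reflect (line_shift x)"

lemma bounded_defect: "bounded_operator ell2 defect"
  unfolding defect_def
  by (rule ell2.bounded_operator_diff[OF ell2.bounded_operator_compose[OF bounded_cycles bounded_reflect]
        ell2.bounded_operator_compose[OF bounded_reflect bounded_operator_line_shift]])

text \<open>Extending \<open>q\<close> to an involution of all indices makes injectivity immediate;
  its values matter only at line starts.\<close>

fun swap :: "idx \<Rightarrow> idx" where
  "swap (Fwd k a b) = Fwd (q k) a b"
| "swap (Bwd k a b) = Bwd k a b"

lemma swap_swap: "swap (swap i) = i"
  by (cases i) auto

text \<open>Inside a window, radius and angle nearly agree at successive points. Between windows the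
  angle jumps from nearly \<open>pi / 2\<close> to \<open>0\<close>, and exactly there the cycles
  and the lines continue on different strands; the two discrepancies cancel up to a small
  error.\<close>

lemma defect_le:
  assumes "\<not> line_start i"
  shows "cmod (defect x (enc i)) \<le> 8 / (real (idx_size i) + 1) * cmod (x (enc (line_pred i)))
    + 8 / (real (idx_size i) + 1) * cmod (x (enc (partner (line_pred i))))"
proof -
  define K where "K = 8 / (real (idx_size i) + 1)"
  have "\<exists>A B. \<bar>A\<bar> \<le> K \<and> \<bar>B\<bar> \<le> K \<and> defect x (enc i) =
      complex_of_real A * x (enc (line_pred i)) + complex_of_real B * x (enc (partner (line_pred i)))"
  proof (cases i rule: line_pred.cases)
    case [simp]: (1 k a b)
    show ?thesis
    proof (cases "k < d")
      case True
      then have k: "k = 0" using d by auto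
      \<comment> \<open>This is line \<open>0\<close> with \<open>d = 1\<close>: the unweighted
        shift is compared with weights increasing to \<open>1\<close>.\<close>
      have "1 - radius k (Suc (a + b)) = 1 / (real (Suc (a + b)) + 1)"
        by (simp add: radius_def k field_simps)
      then have "\<bar>1 - radius k (Suc (a + b))\<bar> \<le> K" by (simp add: K_def k divide_right_mono)
      then show ?thesis using True
        by (intro exI[of _ "1 - radius k (Suc (a + b))"] exI[of _ 0])
          (simp add: defect_def cycles_def line_shift_def reflect_simps algebra_simps K_def)
    next
      case False
      define j where "j = Suc (a + b)"
      define A where "A = radius (k - d) j * cos (angle a (Suc b)) - radius k j * cos (angle (Suc a) b)"
      define B where "B = - (radius (k - d) j * sin (angle a (Suc b)) - radius (k - d) j * sin (angle (Suc a) b))"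
      have step: "real j * \<bar>angle a (Suc b) - angle (Suc a) b\<bar> \<le> 2"
        using angle_step[of a b] mult_right_mono[of "real j" "real a + real b + 2" "\<bar>angle (Suc a) b - angle a (Suc b)\<bar>"]
        by (simp add: j_def abs_minus_commute)
      have N: "real (idx_size i) + 1 \<le> 2 * (real j + real (k - d) + 1)"
        using d False by (simp add: j_def)
      have kd: "\<bar>real (k - d) - real k\<bar> \<le> 1" using d False by (simp add: of_nat_diff)
      have "\<bar>A\<bar> \<le> K" unfolding A_def K_def
        using kd N order_trans[OF mult_left_mono[OF abs_cos_diff_le] step]
        by (intro radius_mult_diff) auto
      moreover have "\<bar>B\<bar> \<le> K" unfolding B_def K_def abs_minus_cancel
        using N order_trans[OF mult_left_mono[OF abs_sin_diff_le] step]
        by (intro radius_mult_diff) auto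
      moreover have "defect x (enc i) = complex_of_real A * x (enc (line_pred i)) + complex_of_real B * x (enc (partner (line_pred i)))"
        using False by (simp add: A_def B_def j_def defect_def cycles_def line_shift_def reflect_simps algebra_simps)
      ultimately show ?thesis by blast
    qed
  next
    case [simp]: (2 k b)
    show ?thesis
    proof (cases "k < d")
      case True
      then have k: "k = 0" using d by auto
      have "1 - radius k (Suc b) = 1 / (real (Suc b) + 1)"
        by (simp add: radius_def k field_simps)
      then have "\<bar>1 - radius k (Suc b)\<bar> \<le> K" by (simp add: K_def k divide_right_mono)
      then show ?thesis using True
        by (intro exI[of _ "1 - radius k (Suc b)"] exI[of _ 0])
          (simp add: defect_def cycles_def line_shift_def reflect_simps algebra_simps K_def)
    next
      case False
      define j where "j = Suc b"
      \<comment> \<open>The factors \<open>1\<close> and \<open>0\<close> are the sine and cosine of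
        \<open>pi / 2\<close>, the angle one step beyond the last point of window
        \<open>b\<close>.\<close>
      define A where "A = radius (k - d) j * sin (angle b 0) - radius k j * 1"
      define B where "B = radius (k - d) j * cos (angle b 0) - radius (k - d) j * 0"
      have step: "real j * \<bar>angle b 0 - pi / 2\<bar> \<le> 2"
        using angle_end[of b] by (simp add: j_def add.commute)
      have N: "real (idx_size i) + 1 \<le> 2 * (real j + real (k - d) + 1)"
        using d False by (simp add: j_def)
      have kd: "\<bar>real (k - d) - real k\<bar> \<le> 1" using d False by (simp add: of_nat_diff)
      have "\<bar>A\<bar> \<le> K" unfolding A_def K_def
        using kd N order_trans[OF mult_left_mono[OF abs_sin_diff_le[of "angle b 0" "pi / 2"]] step]
        by (intro radius_mult_diff) auto
      moreover have "\<bar>B\<bar> \<le> K" unfolding B_def K_def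
        using N order_trans[OF mult_left_mono[OF abs_cos_diff_le[of "angle b 0" "pi / 2"]] step]
        by (intro radius_mult_diff) auto
      moreover have "defect x (enc i) = complex_of_real A * x (enc (line_pred i)) + complex_of_real B * x (enc (partner (line_pred i)))"
        using False by (simp add: A_def B_def j_def defect_def cycles_def line_shift_def reflect_simps algebra_simps)
      ultimately show ?thesis by blast
    qed
  next
    case (3 k)
    then show ?thesis using assms by simp
  next
    case [simp]: (4 k a b)
    \<comment> \<open>Backward window \<open>J\<close> belongs to the cycle with index
      \<open>J + 1\<close>, while the lines have radius index \<open>J\<close> there; hence both
      \<open>Suc J\<close> and \<open>J\<close> occur.\<close>
    define J where "J = Suc (a + b)"
    define A where "A = - (radius k (Suc J) * cos (angle a (Suc b)) - radius k J * cos (angle (Suc a) b))"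
    define B where "B = - (radius k (Suc J) * sin (angle a (Suc b)) - radius (k + d) J * sin (angle (Suc a) b))"
    have step: "real (Suc J) * \<bar>angle a (Suc b) - angle (Suc a) b\<bar> \<le> 2"
      using angle_step[of a b] by (simp add: J_def abs_minus_commute add.commute)
    have N: "real (idx_size i) + 1 \<le> 2 * (real (Suc J) + real k + 1)" by (simp add: J_def)
    have kd: "\<bar>real k - real (k + d)\<bar> \<le> 1" using d by simp
    have "\<bar>A\<bar> \<le> K" unfolding A_def K_def abs_minus_cancel
      using N order_trans[OF mult_left_mono[OF abs_cos_diff_le] step]
      by (intro radius_mult_diff) auto
    moreover have "\<bar>B\<bar> \<le> K" unfolding B_def K_def abs_minus_cancel
      using kd N order_trans[OF mult_left_mono[OF abs_sin_diff_le] step]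
      by (intro radius_mult_diff) auto
    moreover have "defect x (enc i) = complex_of_real A * x (enc (line_pred i)) + complex_of_real B * x (enc (partner (line_pred i)))"
      by (simp add: A_def B_def J_def defect_def cycles_def line_shift_def reflect_simps algebra_simps)
    ultimately show ?thesis by blast
  next
    case [simp]: (5 k b)
    define A where "A = - (radius k (Suc b) * sin (angle (Suc b) 0) - radius k b * 1)"
    define B where "B = radius k (Suc b) * cos (angle (Suc b) 0) - radius k b * 0"
    have step: "real (Suc b) * \<bar>angle (Suc b) 0 - pi / 2\<bar> \<le> 2"
      using angle_end[of "Suc b"] mult_right_mono[of "real (Suc b)" "real (Suc b) + 1" "\<bar>angle (Suc b) 0 - pi / 2\<bar>"]
      by simp
    have N: "real (idx_size i) + 1 \<le> 2 * (real (Suc b) + real k + 1)" by simp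
    have "\<bar>A\<bar> \<le> K" unfolding A_def K_def abs_minus_cancel
      using N order_trans[OF mult_left_mono[OF abs_sin_diff_le[of "angle (Suc b) 0" "pi / 2"]] step]
      by (intro radius_mult_diff) auto
    moreover have "\<bar>B\<bar> \<le> K" unfolding B_def K_def
      using N order_trans[OF mult_left_mono[OF abs_cos_diff_le[of "angle (Suc b) 0" "pi / 2"]] step]
      by (intro radius_mult_diff) auto
    moreover have "defect x (enc i) = complex_of_real A * x (enc (line_pred i)) + complex_of_real B * x (enc (partner (line_pred i)))"
      by (simp add: A_def B_def defect_def cycles_def line_shift_def reflect_simps algebra_simps)
    ultimately show ?thesis by blast
  qed
  then show ?thesis unfolding K_def using norm_comb_le by metis
qed

lemma defect_line_start: "defect x (enc (Fwd k 0 0)) = z k * x (enc (Fwd (q k) 0 0))"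
proof -
  have "reflect y (enc (Fwd k 0 0)) = y (enc (Fwd k 0 0))" for y k
    by (cases "k < d") (simp_all add: reflect_simps)
  then show ?thesis by (simp add: defect_def cycles_def line_shift_def)
qed

text \<open>Three weighted partial injections dominate \<open>defect\<close>: one along the lines,
  one to the partners of the line predecessors, and one swapping the line starts with weights
  \<open>z\<close>.\<close>

lemma vanishing_defect: "vanishing defect"
proof -
  define w where "w i = complex_of_real (if line_start i then 0 else 8 / (real (idx_size i) + 1))" for i
  define v where "v i = (if line_start i then cycle_weight i else 0)" for i
  have sq: "1 / (real n + 1) \<le> 1 / sqrt (real n + 1)" for n
  proof -
    have "sqrt (real n + 1) \<le> real n + 1" by (rule real_le_lsqrt) (auto simp: power2_eq_square)
    then show ?thesis by (simp add: frac_le)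
  qed
  have w: "cmod (w i) \<le> 8 / sqrt (real (idx_size i) + 1)" for i
    using sq[of "idx_size i"] by (auto simp: w_def)
  have v: "cmod (v i) \<le> 8 / sqrt (real (idx_size i) + 1)" for i
  proof (cases "line_start i")
    case True
    then obtain k where "i = Fwd k 0 0" by (auto simp: line_start_def)
    then show ?thesis using order_trans[OF z_le[of k], of "8 / sqrt (real k + 1)"]
      by (simp add: v_def divide_right_mono)
  qed (simp add: v_def)
  have wi: "inj_on line_pred {i. w i \<noteq> 0}"
    by (rule inj_on_subset[OF inj_on_line_pred]) (auto simp: w_def)
  have wi': "inj_on (\<lambda>i. partner (line_pred i)) {i. w i \<noteq> 0}"
    using comp_inj_on[OF wi, of partner] by (metis (no_types, lifting) comp_def inj_on_cong inj_on_inverseI partner_partner)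
  have vi: "inj_on swap {i. v i \<noteq> 0}"
    by (rule inj_on_inverseI[of _ swap]) (simp add: swap_swap)
  define W where "W r = (if r = (0::nat) then pullback w line_pred
    else if r = 1 then pullback w (\<lambda>i. partner (line_pred i)) else pullback v swap)" for r
  show ?thesis
  proof (rule vanishing_dominated[of "{0,1,2}" W])
    show "vanishing (W r)" for r
      by (auto simp: W_def intro!: vanishing_pullback[OF w] vanishing_pullback[OF v] wi wi' vi)
    have "bounded_operator ell2 (W r)" for r
    proof -
      have 8: "8 / sqrt (real n + 1) \<le> 8" for n
        using divide_left_mono[of 1 "sqrt (real n + 1)" 8] by simp
      show ?thesis
        using order_trans[OF w 8] order_trans[OF v 8] wi wi' vi
        by (auto simp: W_def intro!: bounded_operator_pullback[where B = 8])
    qed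
    then show "W r x \<in> hcarrier ell2" if "x \<in> hcarrier ell2" for r x
      using that bounded_operatorD(1) by blast
    show "defect x \<in> hcarrier ell2" if "x \<in> hcarrier ell2" for x
      using that bounded_operatorD(1)[OF bounded_defect] by blast
    show "cmod (defect x n) \<le> (\<Sum>r\<in>{0, 1, 2}. cmod (W r x n))" for x n
    proof -
      obtain i where n: "n = enc i" by (metis enc_dec)
      have "cmod (defect x (enc i)) \<le> (\<Sum>r\<in>{0, 1, 2}. cmod (W r x (enc i)))"
      proof (cases "line_start i")
        case True
        then obtain k where "i = Fwd k 0 0" by (auto simp: line_start_def)
        then show ?thesis by (simp add: W_def defect_line_start v_def)
      next
        case False
        have "real (idx_size i) + 1 > 0" by (simp add: add_nonneg_pos)
        then have "cmod (w i) = 8 / (real (idx_size i) + 1)"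
          using False by (simp only: w_def norm_of_real) simp
        then show ?thesis using defect_le[OF False, of x] False
          by (simp add: W_def norm_mult v_def)
      qed
      then show ?thesis by (simp add: n)
    qed
  qed simp
qed

end

section \<open>Diagonalizing the cycles\<close>

text \<open>Orthogonality of the characters of a cyclic group: a geometric sum whose ratio
  \<open>r\<close> is an \<open>n\<close>-th root of unity, equal to \<open>1\<close> only if
  \<open>a = b\<close>.\<close>

lemma sum_roots_of_unity:
  assumes "a < n" "b < n"
  shows "(\<Sum>p<n. cis (2 * pi * real a * real p / real n) * cnj (cis (2 * pi * real b * real p / real n)))
    = (if a = b then of_nat n else 0)"
proof -
  define w where "w c = cis (2 * pi * real c / real n)" for c
  have n: "n > 0" using assms by simp
  have wp: "w c ^ p = cis (2 * pi * real c * real p / real n)" for c p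
    by (simp add: w_def Complex.DeMoivre mult_ac)
  have wn: "w c ^ n = 1" for c
    using n cis_multiple_2pi[of "real c"] by (simp add: wp)
  define r where "r = w a * cnj (w b)"
  have cw: "cnj (w b) = inverse (w b)" by (simp add: w_def cis_cnj[symmetric] cis_inverse)
  have w0: "w b \<noteq> 0" by (simp add: w_def)
  have "(\<Sum>p<n. cis (2 * pi * real a * real p / real n) * cnj (cis (2 * pi * real b * real p / real n)))
      = (\<Sum>p<n. r ^ p)"
    by (simp add: r_def power_mult_distrib wp[symmetric])
  also have "\<dots> = (if a = b then of_nat n else 0)"
  proof (cases "a = b")
    case True
    then have "r = 1" using w0 cw by (simp add: r_def)
    then show ?thesis using True by simp
  next
    case False
    have "w a \<noteq> w b"
      using Complex.bij_betw_roots_unity[OF n] False assms by (auto simp: bij_betw_def inj_on_def w_def)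
    moreover have "r = w a / w b" by (simp only: r_def cw divide_inverse)
    ultimately have "r \<noteq> 1" using w0 by simp
    moreover have "r ^ n = 1" by (simp add: r_def power_mult_distrib wn complex_cnj_power[symmetric])
    ultimately show ?thesis using False by (simp add: sum_gp_strict)
  qed
  finally show ?thesis .
qed

text \<open>Cycle coordinates for \<open>d = 0\<close>: line and forward window \<open>j\<close>,
  with positions counted from the first point of that window. Backward points come after
  \<open>j + 1\<close> forward ones, so with \<open>j = a + b + 1\<close> their position is
  \<open>(j + 1) + a = 2 a + b + 2\<close>.\<close>

fun cycle_of :: "idx \<Rightarrow> nat \<times> nat" where
  "cycle_of (Fwd k a b) = (k, a + b)"
| "cycle_of (Bwd k a b) = (k, Suc (a + b))"

fun pos :: "idx \<Rightarrow> nat" where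
  "pos (Fwd k a b) = a"
| "pos (Bwd k a b) = Suc (Suc (2 * a + b))"

definition at_pos :: "nat \<times> nat \<Rightarrow> nat \<Rightarrow> idx" where
  "at_pos c l = (if l \<le> snd c then Fwd (fst c) l (snd c - l)
     else Bwd (fst c) (l - Suc (snd c)) (2 * snd c - l))"

lemma at_pos_pos: "at_pos (cycle_of i) (pos i) = i"
  by (cases i) (auto simp: at_pos_def)

lemma pos_less: "pos i < Suc (2 * snd (cycle_of i))"
  by (cases i) auto

lemma cycle_of_at_pos:
  assumes "l < Suc (2 * snd c)"
  shows "cycle_of (at_pos c l) = c" "pos (at_pos c l) = l"
  using assms by (cases c; auto simp: at_pos_def)+

lemma ell2_inner_cycle:
  assumes "\<And>i. cycle_of i \<noteq> c \<Longrightarrow> x (enc i) = 0"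
  shows "hinner ell2 x y = (\<Sum>l<Suc (2 * snd c). x (enc (at_pos c l)) * cnj (y (enc (at_pos c l))))"
proof -
  define A where "A = (\<lambda>l. enc (at_pos c l)) ` {..<Suc (2 * snd c)}"
  have "x n = 0" if "n \<notin> A" for n
  proof -
    have "enc (dec n) \<notin> A" using that by simp
    then have "cycle_of (dec n) \<noteq> c"
      using at_pos_pos[of "dec n"] pos_less[of "dec n"] unfolding A_def by (metis imageI lessThan_iff)
    then show ?thesis using assms[of "dec n"] by simp
  qed
  then have "hinner ell2 x y = (\<Sum>\<^sub>\<infinity>n\<in>A. x n * cnj (y n))"
    unfolding ell2_inner by (intro infsum_cong_neutral) auto
  also have "\<dots> = (\<Sum>n\<in>A. x n * cnj (y n))" by (simp add: A_def)
  also have "\<dots> = (\<Sum>l<Suc (2 * snd c). x (enc (at_pos c l)) * cnj (y (enc (at_pos c l))))"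
    unfolding A_def
  proof (subst sum.reindex)
    show "inj_on (\<lambda>l. enc (at_pos c l)) {..<Suc (2 * snd c)}"
      by (rule inj_on_inverseI[of _ "\<lambda>n. pos (dec n)"]) (simp add: cycle_of_at_pos)
  qed simp
  finally show ?thesis .
qed

text \<open>A cycle of length \<open>2j + 1\<close> has one edge of negative sign, so its eigenvectors are built from
  the roots of \<open>-1\<close>. They are indexed by the points of the cycle itself.\<close>

definition phase :: "idx \<Rightarrow> real" where
  "phase i = pi * (2 * real (pos i) + 1) / real (Suc (2 * snd (cycle_of i)))"

definition eigvec :: "idx \<Rightarrow> nat \<Rightarrow> complex" where
  "eigvec i = (\<lambda>n. if cycle_of (dec n) = cycle_of i
     then cis (- phase i * real (pos (dec n))) / sqrt (real (Suc (2 * snd (cycle_of i)))) else 0)"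

lemma eigvec_apply:
  "eigvec i (enc m) = (if cycle_of m = cycle_of i
     then cis (- phase i * real (pos m)) / sqrt (real (Suc (2 * snd (cycle_of i)))) else 0)"
  by (simp add: eigvec_def)

text \<open>Separates the roots of unity, to which \<open>sum_roots_of_unity\<close> applies, from a
  twist common to all eigenvectors of the cycle.\<close>

lemma cis_phase: "cycle_of i = c \<Longrightarrow> cis (phase i * x)
    = cis (2 * pi * real (pos i) * x / real (Suc (2 * snd c))) * cis (pi * x / real (Suc (2 * snd c)))"
  by (simp add: phase_def cis_mult distrib_left distrib_right add_divide_distrib mult_ac add_ac)

lemma eigvec_carrier: "eigvec i \<in> hcarrier ell2"
proof (rule ell2_finite_support(1))
  show "finite (enc ` at_pos (cycle_of i) ` {..<Suc (2 * snd (cycle_of i))})" by simp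
  fix n assume *: "n \<notin> enc ` at_pos (cycle_of i) ` {..<Suc (2 * snd (cycle_of i))}"
  have "cycle_of (dec n) \<noteq> cycle_of i"
  proof
    assume "cycle_of (dec n) = cycle_of i"
    then have "dec n \<in> at_pos (cycle_of i) ` {..<Suc (2 * snd (cycle_of i))}"
      using at_pos_pos[of "dec n"] pos_less[of "dec n"] by (metis imageI lessThan_iff)
    then show False using * by (metis enc_dec imageI)
  qed
  then show "eigvec i n = 0" by (simp add: eigvec_def)
qed

lemma eigvec_orthonormal: "hinner ell2 (eigvec i) (eigvec m) = (if i = m then 1 else 0)"
proof (cases "cycle_of m = cycle_of i")
  case False
  then show ?thesis
    using ell2_inner_cycle[of "cycle_of i" "eigvec i" "eigvec m"]
    by (auto simp: eigvec_apply cycle_of_at_pos)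
next
  case True
  define c where "c = cycle_of i"
  define n where "n = Suc (2 * snd c)"
  have n0: "of_nat n \<noteq> (0 :: complex)" by (simp only: n_def of_nat_eq_0_iff)
  have ci: "cycle_of i = c" "cycle_of m = c" using True by (simp_all add: c_def)
  have "hinner ell2 (eigvec i) (eigvec m) = (\<Sum>l<n. eigvec i (enc (at_pos c l)) * cnj (eigvec m (enc (at_pos c l))))"
    unfolding n_def by (rule ell2_inner_cycle) (simp add: eigvec_apply ci)
  also have "\<dots> = (\<Sum>l<n. cis (2 * pi * real (pos m) * real l / real n)
      * cnj (cis (2 * pi * real (pos i) * real l / real n)) / of_nat n)"
  proof (rule sum.cong)
    fix l assume "l \<in> {..<n}"
    then have l: "l < Suc (2 * snd c)" by (simp add: n_def)
    have "eigvec i (enc (at_pos c l)) * cnj (eigvec m (enc (at_pos c l)))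
        = cnj (cis (phase i * real l)) * cis (phase m * real l) / of_nat n"
      using l by (simp add: eigvec_apply cycle_of_at_pos ci n_def[symmetric] cis_cnj of_real_mult[symmetric]
          del: of_real_mult)
    also have "\<dots> = cis (2 * pi * real (pos m) * real l / real n)
      * cnj (cis (2 * pi * real (pos i) * real l / real n)) / of_nat n
      * (cis (pi * real l / real n) * cnj (cis (pi * real l / real n)))"
      unfolding cis_phase[OF ci(1)] cis_phase[OF ci(2)] n_def[symmetric] by simp
    also have "cis (pi * real l / real n) * cnj (cis (pi * real l / real n)) = 1"
      by (simp add: cis_cnj cis_mult)
    finally show "eigvec i (enc (at_pos c l)) * cnj (eigvec m (enc (at_pos c l)))
      = cis (2 * pi * real (pos m) * real l / real n)
      * cnj (cis (2 * pi * real (pos i) * real l / real n)) / of_nat n" by simp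
  qed simp
  also have "\<dots> = (if pos m = pos i then of_nat n else 0) / of_nat n"
    unfolding sum_divide_distrib[symmetric]
    using pos_less[of i] pos_less[of m] by (subst sum_roots_of_unity) (auto simp: ci n_def)
  also have "\<dots> = (if i = m then 1 else 0)"
    using at_pos_pos[of i] at_pos_pos[of m] n0 by (auto simp: ci)
  finally show ?thesis .
qed

text \<open>The inverse Fourier transform on one cycle: \<open>g\<close> holds the conjugated values
  of the eigenvectors at \<open>m\<close>. The sum now runs over the eigenvectors, and the twist
  leaves it as a constant factor.\<close>

lemma unit_seq_in_span_eigvec: "unit_seq (enc m) \<in> ell2.span (range eigvec)"
proof -
  define c where "c = cycle_of m"
  define n where "n = Suc (2 * snd c)"
  have n0: "of_nat n \<noteq> (0 :: complex)" by (simp only: n_def of_nat_eq_0_iff)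
  define v where "v p = eigvec (at_pos c p)" for p
  define g where "g p = cis (phase (at_pos c p) * real (pos m)) / sqrt (real n)" for p
  have "unit_seq (enc m) = (\<Sum>p<n. hscale ell2 (g p) (v p))"
  proof (rule seq_eqI)
    fix i
    show "unit_seq (enc m) (enc i) = (\<Sum>p<n. hscale ell2 (g p) (v p)) (enc i)"
    proof (cases "cycle_of i = c")
      case False
      then have "v p (enc i) = 0" if "p < n" for p
        using that by (simp add: v_def eigvec_apply cycle_of_at_pos n_def)
      then show ?thesis using False by (auto simp: sum_fun_apply ell2_scale unit_seq_apply c_def)
    next
      case True
      have "(\<Sum>p<n. hscale ell2 (g p) (v p)) (enc i) = (\<Sum>p<n. g p * v p (enc i))"
        by (simp add: sum_fun_apply ell2_scale)
      also have "\<dots> = (\<Sum>p<n. cis (2 * pi * real (pos m) * real p / real n)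
          * cnj (cis (2 * pi * real (pos i) * real p / real n))
          * (cis (pi * real (pos m) / real n) * cnj (cis (pi * real (pos i) / real n)) / of_nat n))"
      proof (rule sum.cong)
        fix p assume "p \<in> {..<n}"
        then have p: "p < Suc (2 * snd c)" by (simp add: n_def)
        have "g p * v p (enc i) = cis (phase (at_pos c p) * real (pos m))
            * cnj (cis (phase (at_pos c p) * real (pos i))) / of_nat n"
          using p True by (simp add: g_def v_def eigvec_apply cycle_of_at_pos n_def[symmetric] cis_cnj
              of_real_mult[symmetric] del: of_real_mult)
        then show "g p * v p (enc i) = cis (2 * pi * real (pos m) * real p / real n)
          * cnj (cis (2 * pi * real (pos i) * real p / real n))
          * (cis (pi * real (pos m) / real n) * cnj (cis (pi * real (pos i) / real n)) / of_nat n)"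
          unfolding cis_phase[OF cycle_of_at_pos(1)[OF p]] cycle_of_at_pos(2)[OF p] n_def[symmetric]
          by (simp add: mult_ac)
      qed simp
      also have "\<dots> = (if pos m = pos i then of_nat n else 0)
          * (cis (pi * real (pos m) / real n) * cnj (cis (pi * real (pos i) / real n)) / of_nat n)"
        unfolding sum_distrib_right[symmetric]
        using pos_less[of i] pos_less[of m] True by (subst sum_roots_of_unity) (auto simp: c_def n_def)
      also have "\<dots> = (if pos m = pos i then 1 else 0)"
        using n0 by (simp add: cis_cnj cis_mult)
      also have "\<dots> = unit_seq (enc m) (enc i)"
        using at_pos_pos[of i] at_pos_pos[of m] True by (auto simp: unit_seq_apply c_def)
      finally show ?thesis by simp
    qed
  qed
  then show ?thesis
    by (simp add: v_def ell2.span_sum ell2.span_scale ell2.span_base)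
qed

locale diagonal_cycles = weighted_cycles 0 z "\<lambda>k. k" for z
begin

definition eigval :: "idx \<Rightarrow> complex" where
  "eigval i = (case cycle_of i of (k, j) \<Rightarrow>
     if j = 0 then z k else complex_of_real (radius k j) * cis (phase i))"

lemma cycles_eigvec: "cycles (eigvec i) = hscale ell2 (eigval i) (eigvec i)"
proof (rule seq_eqI)
  fix m
  obtain k j where c: "cycle_of i = (k, j)" by fastforce
  \<comment> \<open>Once round the cycle the phase accumulates to \<open>-1\<close>, which the
    negative edge compensates.\<close>
  have turn: "cis (phase i * (real (2 * j) + 1)) = - 1"
  proof -
    have "phase i * (real (2 * j) + 1) = 2 * pi * real (pos i) + pi"
      by (simp add: phase_def c field_simps)
    then show ?thesis by (simp add: cis_mult[symmetric])
  qed
  have step: "cis (- phase i * real l) = cis (phase i) * cis (- phase i * real (Suc l))" for l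
    by (simp add: cis_mult algebra_simps)
  have close: "- cis (- phase i * real (2 * j)) = cis (phase i)"
  proof -
    have "cis (phase i) = cis (phase i * (real (2 * j) + 1)) * cis (- phase i * real (2 * j))"
      by (simp add: cis_mult algebra_simps)
    then show ?thesis using turn by simp
  qed
  show "cycles (eigvec i) (enc m) = hscale ell2 (eigval i) (eigvec i) (enc m)"
  proof (cases "cycle_of m = (k, j)")
    case False
    then have "cycle_of (cycle_pred m) \<noteq> (k, j) \<or> cycle_weight m = 0"
      by (cases m rule: cycle_pred.cases) auto
    then show ?thesis using False by (auto simp: cycles_def ell2_scale eigvec_apply c)
  next
    case True
    have ev: "eigvec i (enc m') = cis (- phase i * real (pos m')) / sqrt (real (Suc (2 * j)))"
      if "cycle_of m' = (k, j)" for m' using that by (simp add: eigvec_apply c)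
    show ?thesis
    proof (cases m rule: cycle_pred.cases)
      case (1 k' a b)
      then show ?thesis using True step[of a]
        by (auto simp: cycles_def ell2_scale ev eigval_def c simp del: of_nat_Suc)
    next
      case (2 k' b)
      then have "2 * j = Suc (Suc (2 * b))" using True by simp
      note close' = close[unfolded this]
      show ?thesis using 2 True
        by (auto simp: cycles_def ell2_scale ev eigval_def c close'[symmetric] simp del: of_nat_Suc)
    next
      case (3 k')
      then show ?thesis using True
        by (auto simp: cycles_def ell2_scale ev eigval_def c)
    next
      case (4 k' a b)
      then show ?thesis using True step[of "Suc (Suc (Suc (2 * a + b)))"]
        by (auto simp: cycles_def ell2_scale ev eigval_def c simp del: of_nat_Suc)
    next
      case (5 k' b)
      then show ?thesis using True step[of "Suc b"]
        by (auto simp: cycles_def ell2_scale ev eigval_def c simp del: of_nat_Suc)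
    qed
  qed
qed

lemma reflect_unit_seq: "reflect (unit_seq (enc i))
    = hscale ell2 (refl_diag i) (unit_seq (enc i)) + hscale ell2 (refl_off i) (unit_seq (enc (partner i)))"
proof (rule seq_eqI)
  fix m
  have "refl_off (partner i) = refl_off i" by (cases i) auto
  moreover have "partner m = i \<longleftrightarrow> m = partner i" by (metis partner_partner)
  ultimately show "reflect (unit_seq (enc i)) (enc m) = (hscale ell2 (refl_diag i) (unit_seq (enc i))
      + hscale ell2 (refl_off i) (unit_seq (enc (partner i)))) (enc m)"
    by (auto simp: reflect_apply ell2_scale unit_seq_apply)
qed

lemma reflect_span:
  assumes "x \<in> ell2.span A"
  shows "reflect x \<in> ell2.span (reflect ` A)"
proof (rule ell2.span_induct[OF assms])
  show "ell2.subspace {x. reflect x \<in> ell2.span (reflect ` A)}"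
  proof (rule ell2.subspaceI)
    have "reflect 0 = 0" by (rule seq_eqI) (simp add: reflect_apply)
    then show "0 \<in> {x. reflect x \<in> ell2.span (reflect ` A)}" by (simp add: ell2.span_zero)
  qed (auto simp: reflect_add reflect_scale ell2.span_add ell2.span_scale)
qed (auto intro: ell2.span_base)

lemma diagonal_operator_op: "diagonal_operator ell2 op"
proof -
  define e where "e n = reflect (eigvec (dec n))" for n
  have "orthonormal_basis ell2 e"
  proof (rule ell2_orthonormal_basisI)
    show "e n \<in> hcarrier ell2" for n
      unfolding e_def by (intro bounded_operatorD(1)[OF bounded_reflect] eigvec_carrier)
    show "hinner ell2 (e m) (e n) = (if m = n then 1 else 0)" for m n
    proof -
      have "hinner ell2 (e m) (e n) = hinner ell2 (eigvec (dec m)) (reflect (e n))"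
        unfolding e_def using adjoint_pairD(3)[OF adjoint_pair_reflect eigvec_carrier]
          bounded_operatorD(1)[OF bounded_reflect eigvec_carrier] by blast
      also have "\<dots> = (if dec m = dec n then 1 else 0)"
        by (simp add: e_def eigvec_orthonormal)
      finally show ?thesis by (metis enc_dec)
    qed
    have "range e = reflect ` range eigvec"
      unfolding e_def by (auto simp: image_iff) (metis dec_enc)
    then have r: "reflect x \<in> ell2.span (range e)" if "x \<in> ell2.span (range eigvec)" for x
      using reflect_span[OF that] by simp
    show "unit_seq n \<in> ell2.span (range e)" for n
    proof -
      \<comment> \<open>As \<open>reflect\<close> is an involution, \<open>unit_seq n\<close> is the
        reflection of a vector in the span of the eigenvectors.\<close>
      have "reflect (unit_seq (enc (dec n))) \<in> ell2.span (range eigvec)"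
        unfolding reflect_unit_seq
        by (intro ell2.span_add ell2.span_scale unit_seq_in_span_eigvec)
      from r[OF this] show ?thesis by simp
    qed
  qed
  moreover have "bounded (range (\<lambda>n. eigval (dec n)))"
    unfolding bounded_iff
  proof (intro exI ballI)
    fix l assume "l \<in> range (\<lambda>n. eigval (dec n))"
    then obtain i where l: "l = eigval i" by auto
    have "radius k j \<le> 2" for k j using radius_le_1[of k j] by simp
    then show "norm l \<le> 2"
      by (auto simp: l eigval_def norm_mult radius_nonneg z_le_2 split: prod.split)
  qed
  moreover have "op (e n) = hscale ell2 (eigval (dec n)) (e n)" for n
    by (simp add: e_def op_def cycles_eigvec reflect_scale)
  ultimately show ?thesis
    unfolding diagonal_operator_def using adjoint_pairD(1)[OF adjoint_pair_op] by blast
qed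

end

section \<open>The two operators\<close>

context weighted_cycles
begin

text \<open>The angle is \<open>0\<close> in window \<open>0\<close>, so conjugation by
  \<open>reflect\<close> does not change the blocks that \<open>z\<close> and \<open>q\<close>
  prescribe.\<close>

lemma reflect_line_start: "reflect (unit_seq (enc (Fwd k 0 0))) = unit_seq (enc (Fwd k 0 0))"
proof (rule seq_eqI)
  fix i
  show "reflect (unit_seq (enc (Fwd k 0 0))) (enc i) = unit_seq (enc (Fwd k 0 0)) (enc i)"
    by (cases i) (auto simp: reflect_apply unit_seq_apply)
qed

lemma op_line_start:
  assumes "d \<le> k"
  shows "op (unit_seq (enc (Fwd k 0 0))) = hscale ell2 (z (q k)) (unit_seq (enc (Fwd (q k) 0 0)))"
  using assms pullback_unit_seq[OF cycle_inverse, of "Fwd k 0 0"]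
  by (simp add: op_def reflect_line_start reflect_scale cycles_def)

lemma op'_line_start:
  "op' (unit_seq (enc (Fwd k 0 0))) = hscale ell2 (cnj (z k)) (unit_seq (enc (Fwd (q k) 0 0)))"
proof -
  have "inverse_weights cycle_weight' cycle_succ cycle_weight cycle_pred"
    using cycle_inverse by (auto simp: inverse_weights_def)
  from pullback_unit_seq[OF this, of "Fwd k 0 0"] show ?thesis
    by (simp add: op'_def reflect_line_start reflect_scale cycles'_def)
qed

text \<open>Each cycle has weights of constant modulus, and the assumption on \<open>z\<close>
  balances the other line starts; only the start of an unweighted line has outgoing weight
  \<open>1\<close> and incoming weight \<open>0\<close>.\<close>

lemma cycle_weights_balanced:
  assumes "\<And>k. cmod (z (q k)) = cmod (z k)"
  shows "(cmod (cycle_weight' i))\<^sup>2 - (cmod (cycle_weight i))\<^sup>2 = (if \<exists>k<d. i = Fwd k 0 0 then 1 else 0)"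
proof -
  consider k where "i = Fwd k 0 0" | k b where "i = Fwd k 0 (Suc b)" | k a where "i = Fwd k (Suc a) 0"
    | k a b where "i = Fwd k (Suc a) (Suc b)" | k where "i = Bwd k 0 0" | k b where "i = Bwd k 0 (Suc b)"
    | k a where "i = Bwd k (Suc a) 0" | k a b where "i = Bwd k (Suc a) (Suc b)"
    by (metis idx.exhaust nat.exhaust)
  then show ?thesis
    by cases (auto simp: assms zd)
qed

text \<open>The self-commutator of \<open>cycles\<close> is diagonal, with the differences of the
  squared weights as entries. Only the start of the shift survives, and \<open>reflect\<close> fixes
  that vector.\<close>

lemma self_commutator_op:
  assumes "d = 1" and zq: "\<And>k. cmod (z (q k)) = cmod (z k)" and x: "x \<in> hcarrier ell2"
  shows "self_commutator ell2 op x = hscale ell2 (x (enc (Fwd 0 0 0))) (unit_seq (enc (Fwd 0 0 0)))"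
proof -
  define y where "y = reflect x"
  \<comment> \<open>Where the weight vanishes both sides are \<open>0\<close>; elsewhere the two
    index maps cancel.\<close>
  have inv: "cycle_weight' i * cycle_weight (cycle_succ i) * y (enc (cycle_pred (cycle_succ i)))
      = complex_of_real ((cmod (cycle_weight' i))\<^sup>2) * y (enc i)"
    "cycle_weight i * cycle_weight' (cycle_pred i) * y (enc (cycle_succ (cycle_pred i)))
      = complex_of_real ((cmod (cycle_weight i))\<^sup>2) * y (enc i)" for i
    using cycle_inverse unfolding inverse_weights_def complex_norm_square
    by (metis mult_zero_left)+
  have y0: "y (enc (Fwd 0 0 0)) = x (enc (Fwd 0 0 0))"
  proof -
    have "0 < d" using assms(1) by simp
    then show ?thesis by (simp add: y_def reflect_simps(1))
  qed
  have *: "cycles' (cycles y) - cycles (cycles' y)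
      = hscale ell2 (x (enc (Fwd 0 0 0))) (unit_seq (enc (Fwd 0 0 0)))"
  proof (rule seq_eqI)
    fix i
    have "(cycles' (cycles y) - cycles (cycles' y)) (enc i)
        = complex_of_real ((cmod (cycle_weight' i))\<^sup>2) * y (enc i)
          - complex_of_real ((cmod (cycle_weight i))\<^sup>2) * y (enc i)"
      by (simp only: minus_apply cycles_def cycles'_def pullback_apply mult.assoc[symmetric] inv)
    also have "\<dots> = complex_of_real ((cmod (cycle_weight' i))\<^sup>2 - (cmod (cycle_weight i))\<^sup>2) * y (enc i)"
      by (simp only: of_real_diff left_diff_distrib)
    also have "\<dots> = (if i = Fwd 0 0 0 then y (enc i) else 0)"
      unfolding cycle_weights_balanced[OF zq] using assms(1) by auto
    finally show "(cycles' (cycles y) - cycles (cycles' y)) (enc i)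
        = hscale ell2 (x (enc (Fwd 0 0 0))) (unit_seq (enc (Fwd 0 0 0))) (enc i)"
      using y0 by (simp add: ell2_scale unit_seq_apply)
  qed
  have yc: "y \<in> hcarrier ell2" using bounded_operatorD(1)[OF bounded_reflect x] by (simp add: y_def)
  have cc: "cycles v \<in> hcarrier ell2" "cycles' v \<in> hcarrier ell2" if "v \<in> hcarrier ell2" for v
    using bounded_operatorD(1)[OF bounded_cycles that]
      bounded_operatorD(1)[OF adjoint_pairD(2)[OF adjoint_pair_cycles] that] .
  have "self_commutator ell2 op x = reflect (cycles' (cycles y)) - reflect (cycles (cycles' y))"
    using ell2.self_commutator_eq[OF adjoint_pair_op x] by (simp add: op_def op'_def y_def)
  also have "\<dots> = reflect (cycles' (cycles y) - cycles (cycles' y))"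
    by (simp add: reflect_diff)
  also have "\<dots> = hscale ell2 (x (enc (Fwd 0 0 0))) (unit_seq (enc (Fwd 0 0 0)))"
    unfolding * by (simp add: reflect_scale reflect_line_start)
  finally show ?thesis .
qed

end

section \<open>Rank-one projections\<close>

definition coord_proj :: "nat \<Rightarrow> (nat \<Rightarrow> complex) \<Rightarrow> nat \<Rightarrow> complex" where
  "coord_proj m x = hscale ell2 (x m) (unit_seq m)"

lemma coord_proj_adjoint: "adjoint_pair ell2 (coord_proj m) (coord_proj m)"
proof -
  have "coord_proj m = wcomp (unit_seq m) (\<lambda>n. n)"
    by (intro ext) (simp add: coord_proj_def wcomp_def ell2_scale unit_seq_apply)
  then show ?thesis
    using adjoint_pair_wcomp[of "unit_seq m" 1 "\<lambda>n. n" "unit_seq m" "\<lambda>n. n"]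
    by (auto simp: inverse_weights_def unit_seq_apply)
qed

lemma coord_proj_inner:
  "x \<in> hcarrier ell2 \<Longrightarrow> hinner ell2 (coord_proj m x) x = complex_of_real ((cmod (x m))\<^sup>2)"
proof -
  assume x: "x \<in> hcarrier ell2"
  have "hinner ell2 (unit_seq m) x = cnj (x m)"
    using ell2.inner_commute[OF unit_seq_carrier x] by (simp add: ell2_inner_unit_seq)
  then show ?thesis
    unfolding coord_proj_def complex_norm_square ell2.inner_scale_left[OF unit_seq_carrier x] by simp
qed

lemma positive_coord_proj: "positive_semidefinite ell2 (coord_proj m)"
  unfolding positive_semidefinite_def
  using adjoint_pairD(1)[OF coord_proj_adjoint] by (auto simp: coord_proj_inner simp del: of_real_power)

lemma positive_semidefinite_cong:
  assumes "positive_semidefinite ell2 A" "\<And>x. x \<in> hcarrier ell2 \<Longrightarrow> A x = B x"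
  shows "positive_semidefinite ell2 B"
  using assms ell2.bounded_operator_cong[of A B] unfolding positive_semidefinite_def by auto

text \<open>A rank-one projection is its own modulus, and its diagonal in the unit basis has a
  single nonzero entry.\<close>

lemma trace_class_coord_proj:
  assumes A: "adjoint_pair ell2 A A" and eq: "\<And>x. x \<in> hcarrier ell2 \<Longrightarrow> A x = coord_proj m x"
  shows "trace_class ell2 A"
  unfolding trace_class_def
proof (intro conjI exI)
  show "bounded_operator ell2 A" using A by (rule adjoint_pairD)
  show "is_modulus ell2 A (coord_proj m)"
    unfolding is_modulus_def
  proof (intro conjI ballI positive_coord_proj)
    fix x assume x: "x \<in> hcarrier ell2"
    have cx: "coord_proj m x \<in> hcarrier ell2"
      using bounded_operatorD(1)[OF adjoint_pairD(1)[OF coord_proj_adjoint] x] .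
    show "coord_proj m (coord_proj m x) = adjoint_op ell2 A (A x)"
      using ell2.adjoint_op_eq[OF A cx] by (simp add: eq x cx)
  qed
  show "orthonormal_basis ell2 unit_seq" by (rule orthonormal_basis_unit_seq)
  show "summable (\<lambda>n. Re (hinner ell2 (coord_proj m (unit_seq n)) (unit_seq n)))"
    by (rule summable_finite[of "{m}"]) (auto simp: coord_proj_inner unit_seq_apply)
qed

section \<open>Couplings at the line starts\<close>

definition mate :: "nat \<Rightarrow> nat" where
  "mate k = (if k = 0 then 0 else if odd k then Suc k else k - 1)"

lemma mate_mate [simp]: "mate (mate k) = k"
  by (auto simp: mate_def elim!: oddE)

lemma mate_pos: "1 \<le> k \<Longrightarrow> 1 \<le> mate k"
  by (auto simp: mate_def elim!: evenE)

lemma odd_mate: "1 \<le> k \<Longrightarrow> odd (mate k) \<longleftrightarrow> even k"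
  by (auto simp: mate_def)

text \<open>These are the \<open>a\<^sub>n\<close>, where \<open>n = Suc k div 2\<close> numbers the
  pair of \<open>2 n - 1\<close> and \<open>2 n\<close> exchanged by \<open>mate\<close>. Index
  \<open>0\<close> stays uncoupled because in \<open>T\<close> it is the start of the shift. The
  decay meets the bound \<open>z_le\<close>, yet the squares form a harmonic-type series.\<close>

definition coupling :: "nat \<Rightarrow> real" where
  "coupling k = (if k = 0 then 0 else 1 / sqrt (1 + real (Suc k div 2)))"

lemma coupling_mate [simp]: "coupling (mate k) = coupling k"
proof -
  have "Suc (mate k) div 2 = Suc k div 2" if "k \<noteq> 0"
    using that by (auto simp: mate_def elim!: evenE oddE)
  moreover have "mate k = 0 \<longleftrightarrow> k = 0" by (auto simp: mate_def elim!: evenE)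
  ultimately show ?thesis by (auto simp: coupling_def)
qed

lemma coupling_nonneg: "0 \<le> coupling k"
  by (simp add: coupling_def)

lemma coupling_sq: "(coupling (Suc k))\<^sup>2 = 1 / (1 + real (Suc (Suc k) div 2))"
  by (simp add: coupling_def power_divide)

lemma coupling_le: "coupling k \<le> 2 / sqrt (real k + 1)"
proof (cases "k = 0")
  case False
  have "Suc k \<le> 4 * (1 + Suc k div 2)" by simp
  from of_nat_mono[OF this, where 'a = real] have "real k + 1 \<le> 4 * (1 + real (Suc k div 2))" by simp
  then have "sqrt (real k + 1) \<le> sqrt (4 * (1 + real (Suc k div 2)))" by simp
  also have "\<dots> = 2 * sqrt (1 + real (Suc k div 2))" by (simp only: real_sqrt_mult real_sqrt_four)
  finally have le: "sqrt (real k + 1) \<le> 2 * sqrt (1 + real (Suc k div 2))" .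
  have "1 / sqrt (1 + real (Suc k div 2)) = 2 / (2 * sqrt (1 + real (Suc k div 2)))" by simp
  also have "\<dots> \<le> 2 / sqrt (real k + 1)"
    using le by (intro divide_left_mono) (auto intro!: mult_pos_pos add_nonneg_pos)
  finally show ?thesis using False by (simp add: coupling_def)
qed (simp add: coupling_def)

lemma not_summable_coupling_sq: "\<not> summable (\<lambda>k. 4 * (coupling (Suc k))\<^sup>2)"
proof
  assume s: "summable (\<lambda>k. 4 * (coupling (Suc k))\<^sup>2)"
  have "summable (\<lambda>k. 1 / real (Suc k))"
  proof (rule summable_comparison_test[OF _ s], intro exI allI impI)
    fix k
    have "1 + Suc (Suc k) div 2 \<le> 4 * Suc k" by simp
    then have "1 + real (Suc (Suc k) div 2) \<le> 4 * real (Suc k)" by linarith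
    then have le: "4 / (4 * real (Suc k)) \<le> 4 / (1 + real (Suc (Suc k) div 2))"
      by (intro divide_left_mono) auto
    have "norm (1 / real (Suc k)) = 4 / (4 * real (Suc k))" by (simp add: field_simps)
    also note le
    also have "4 / (1 + real (Suc (Suc k) div 2)) = 4 * (coupling (Suc k))\<^sup>2"
      by (simp only: coupling_sq times_divide_eq_right mult_1_right)
    finally show "norm (1 / real (Suc k)) \<le> 4 * (coupling (Suc k))\<^sup>2" .
  qed
  then show False
    using not_summable_harmonic[where 'a = real] by (simp add: summable_Suc_iff[of "\<lambda>n. 1 / real n"] inverse_eq_divide del: of_nat_Suc)
qed

definition parity_sign :: "nat \<Rightarrow> real" where
  "parity_sign k = (if odd k then 1 else - 1)"

text \<open>At the line starts \<open>T\<close> receives the blocks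
  \<open>a\<^sub>n \<sigma>\<^sub>x\<close>; the interpretation \<open>D\<close> puts the diagonal
  \<open>\<i> a\<^sub>n \<sigma>\<^sub>z\<close> on the same vectors.\<close>

interpretation T: weighted_cycles 1 "\<lambda>k. complex_of_real (coupling k)" mate
  using mate_pos coupling_le by unfold_locales (auto simp: coupling_nonneg, simp add: coupling_def)

interpretation D: diagonal_cycles "\<lambda>k. \<i> * complex_of_real (parity_sign k * coupling k)"
  using coupling_le by unfold_locales (auto simp: norm_mult coupling_nonneg parity_sign_def)

theorem mainTheorem6:
  shows "\<exists>(H :: (nat \<Rightarrow> complex) hspace) T D K.
           complex_hilbert_space H \<and> infinite_dimensional H \<and> separable H \<and>
           bounded_operator H T \<and> bounded_operator H D \<and> bounded_operator H K \<and>
           (\<forall>x\<in>hcarrier H. T x = D x + K x) \<and>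
           diagonal_operator H D \<and>
           compact_operator H K \<and>
           hyponormal_operator H T \<and>
           trace_class H (self_commutator H T) \<and>
           \<not> normal_operator H T \<and>
           \<not> trace_class H (self_commutator H K)"
proof -
  define K where "K x = T.op x - D.op x" for x
  define K' where "K' x = T.op' x - D.op' x" for x
  define o0 where "o0 = enc (Fwd 0 0 0)"
  have KK': "adjoint_pair ell2 K K'"
    unfolding K_def K'_def by (rule ell2.adjoint_pair_diff[OF T.adjoint_pair_op D.adjoint_pair_op])
  note bT = adjoint_pairD(1)[OF T.adjoint_pair_op] and bD = adjoint_pairD(1)[OF D.adjoint_pair_op]
    and bK = adjoint_pairD(1)[OF KK'] and bK' = adjoint_pairD(2)[OF KK']

  have cT: "self_commutator ell2 T.op x = coord_proj o0 x" if "x \<in> hcarrier ell2" for x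
    using T.self_commutator_op[OF refl _ that] by (simp add: coord_proj_def o0_def)
  have aT: "adjoint_pair ell2 (self_commutator ell2 T.op) (self_commutator ell2 T.op)"
    by (rule ell2.adjoint_pair_self_commutator[OF T.adjoint_pair_op])
  have "hyponormal_operator ell2 T.op"
    unfolding hyponormal_operator_def
    using bT positive_semidefinite_cong[OF positive_coord_proj cT[symmetric]] by blast
  moreover have "trace_class ell2 (self_commutator ell2 T.op)"
    by (rule trace_class_coord_proj[OF aT cT])
  moreover have "\<not> normal_operator ell2 T.op"
  proof
    assume "normal_operator ell2 T.op"
    then have "self_commutator ell2 T.op (unit_seq o0) = 0"
      by (simp add: normal_operator_def self_commutator_def)
    then have "coord_proj o0 (unit_seq o0) = 0" by (metis cT unit_seq_carrier)
    then have "coord_proj o0 (unit_seq o0) o0 = 0" by simp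
    then show False by (simp add: coord_proj_def ell2_scale unit_seq_apply)
  qed
  moreover have "compact_operator ell2 K"
  proof (rule compact_operatorI[OF bK])
    \<comment> \<open>Both operators differ from the same \<open>line_shift\<close> by a reflected
      defect, so it cancels in \<open>K\<close>.\<close>
    have "K x = T.reflect (T.defect x) - D.reflect (D.defect x)" for x
    proof (rule seq_eqI)
      fix i
      have "T.reflect (T.defect x) = T.op x - line_shift x"
        by (simp only: T.defect_def T.op_def T.reflect_diff T.reflect_reflect)
      moreover have "D.reflect (D.defect x) = D.op x - line_shift x"
        by (simp only: D.defect_def D.op_def D.reflect_diff D.reflect_reflect)
      ultimately show "K x (enc i) = (T.reflect (T.defect x) - D.reflect (D.defect x)) (enc i)"
        by (simp add: K_def)
    qed
    then have Keq: "K = (\<lambda>x. T.reflect (T.defect x) - D.reflect (D.defect x))" by blast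
    note tc = bounded_operatorD(1)[OF T.bounded_defect] and dc = bounded_operatorD(1)[OF D.bounded_defect]
    show "vanishing K"
      unfolding Keq
    proof (rule vanishing_diff)
      show "vanishing (\<lambda>x. T.reflect (T.defect x))"
        by (rule vanishing_compose[OF T.bounded_reflect T.vanishing_defect tc])
      show "vanishing (\<lambda>x. D.reflect (D.defect x))"
        by (rule vanishing_compose[OF D.bounded_reflect D.vanishing_defect dc])
      show "T.reflect (T.defect x) \<in> hcarrier ell2" if "x \<in> hcarrier ell2" for x
        by (rule bounded_operatorD(1)[OF T.bounded_reflect tc[OF that]])
      show "D.reflect (D.defect x) \<in> hcarrier ell2" if "x \<in> hcarrier ell2" for x
        by (rule bounded_operatorD(1)[OF D.bounded_reflect dc[OF that]])
    qed
  qed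
  moreover have "\<not> trace_class ell2 (self_commutator ell2 K)"
  proof -
    define C where "C = self_commutator ell2 K"
    define u where "u k = unit_seq (enc (Fwd k 0 0))" for k
    have uc [simp]: "u k \<in> hcarrier ell2" for k by (simp add: u_def)
    have aC: "adjoint_pair ell2 C C"
      unfolding C_def by (rule ell2.adjoint_pair_self_commutator[OF KK'])
    have s: "parity_sign (mate k) = - parity_sign k"
      "complex_of_real (parity_sign k) * complex_of_real (parity_sign k) = 1" if "1 \<le> k" for k
      using odd_mate[OF that] by (auto simp: parity_sign_def)
    \<comment> \<open>On each pair the part from \<open>D\<close> is skew-adjoint and the part from
      \<open>T\<close> self-adjoint, so \<open>K\<close> and \<open>K'\<close> differ only in one
      sign.\<close>
    have Ku: "K (u k) = hscale ell2 (coupling k) (u (mate k)) - hscale ell2 (\<i> * (parity_sign k * coupling k)) (u k)"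
      and K'u: "K' (u k) = hscale ell2 (coupling k) (u (mate k)) + hscale ell2 (\<i> * (parity_sign k * coupling k)) (u k)"
      if "1 \<le> k" for k
      using that T.op_line_start[of k] D.op_line_start[of k] T.op'_line_start[of k] D.op'_line_start[of k]
      by (auto simp: K_def K'_def u_def ell2_scale)
    \<comment> \<open>The squares cancel and twice a commutator of the two blocks remains:
      off-diagonal, of size four times the squared coupling.\<close>
    have Cu: "C (u k) = hscale ell2 (- 4 * \<i> * parity_sign k * (coupling k)\<^sup>2) (u (mate k))" if k: "1 \<le> k" for k
    proof -
      have lin: "A (hscale ell2 a (u i) + hscale ell2 b (u j)) = hscale ell2 a (A (u i)) + hscale ell2 b (A (u j))"
        "A (hscale ell2 a (u i) - hscale ell2 b (u j)) = hscale ell2 a (A (u i)) - hscale ell2 b (A (u j))"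
        if "bounded_operator ell2 A" for A a b i j
      proof -
        show add: "A (hscale ell2 a (u i) + hscale ell2 b (u j)) = hscale ell2 a (A (u i)) + hscale ell2 b (A (u j))" for b
          by (simp add: bounded_operatorD[OF that])
        show "A (hscale ell2 a (u i) - hscale ell2 b (u j)) = hscale ell2 a (A (u i)) - hscale ell2 b (A (u j))"
          using add[of "- b"] by simp
      qed
      have "C (u k) = K' (K (u k)) - K (K' (u k))"
        unfolding C_def by (rule ell2.self_commutator_eq[OF KK' uc])
      also have "\<dots> = hscale ell2 (- 4 * \<i> * parity_sign k * (coupling k)\<^sup>2) (u (mate k))"
        unfolding Ku[OF k] K'u[OF k] lin[OF bK'] lin[OF bK] unfolding Ku[OF k] K'u[OF k] Ku[OF mate_pos[OF k]] K'u[OF mate_pos[OF k]]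
        by (rule ext) (simp add: ell2_scale s[OF k] algebra_simps power2_eq_square)
      finally show ?thesis .
    qed
    \<comment> \<open>The two off-diagonal entries carry opposite signs and a factor
      \<open>\<i>\<close> each, so \<open>C\<close> squared is a positive scalar on the
      pair.\<close>
    have CCu: "C (C (u k)) = hscale ell2 (complex_of_real ((4 * (coupling k)\<^sup>2)\<^sup>2)) (u k)" if k: "1 \<le> k" for k
    proof -
      define e where "e = complex_of_real (parity_sign k)"
      have "(- 4 * \<i> * parity_sign k * (coupling k)\<^sup>2) * (- 4 * \<i> * parity_sign (mate k) * (coupling (mate k))\<^sup>2)
          = complex_of_real ((4 * (coupling k)\<^sup>2)\<^sup>2) * (e * e)"
        by (simp add: s(1)[OF k] e_def power2_eq_square algebra_simps)
      also have "e * e = 1" unfolding e_def by (rule s(2)[OF k])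
      finally show ?thesis
        by (simp only: Cu[OF k] bounded_operatorD(3)[OF adjoint_pairD(1)[OF aC] uc] Cu[OF mate_pos[OF k]]
            ell2.scale_scale mate_mate mult_1_right)
    qed
    have "\<not> trace_class ell2 C"
    \<comment> \<open>\<open>C\<close> is self-adjoint, so \<open>C\<^sup>*C\<close> is its square.
      The index is shifted because line start \<open>0\<close> is uncoupled.\<close>
    proof (rule ell2.not_trace_classI[where u = "\<lambda>k. u (Suc k)" and l = "\<lambda>k. 4 * (coupling (Suc k))\<^sup>2"])
      show "hinner ell2 (u (Suc k)) (u (Suc l)) = (if k = l then 1 else 0)" for k l
        by (auto simp: u_def ell2_inner_unit_seq unit_seq_apply)
      show "adjoint_op ell2 C (C (u (Suc k))) = hscale ell2 (complex_of_real ((4 * (coupling (Suc k))\<^sup>2)\<^sup>2)) (u (Suc k))" for k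
        using ell2.adjoint_op_eq[OF aC bounded_operatorD(1)[OF adjoint_pairD(1)[OF aC] uc]] CCu[of "Suc k"] by simp
      show "4 * (coupling (Suc k))\<^sup>2 > 0" for k
        unfolding coupling_sq by (simp add: add_pos_nonneg)
    qed (use not_summable_coupling_sq in auto)
    then show ?thesis by (simp add: C_def)
  qed
  moreover have "\<forall>x\<in>hcarrier ell2. T.op x = D.op x + K x" by (simp add: K_def)
  ultimately show ?thesis
    using ell2_hilbert ell2_infinite_dimensional ell2_separable bT bD bK D.diagonal_operator_op by blast
qed

end
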